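(* Let $\Omega$ be a bounded Lipschitz domain in $\mathbb R^N$ and let $g:\Omega\times\mathbb R_+\to\mathbb R_+$ be continuous and such that, for each $x\in\Omega$, $t\mapsto h(x,t)=t^{-1}g(x,t)$ is nondecreasing on $(0,\infty)$. Consider the equation $\Delta u(x)=g(x,u(x))$ in $\Omega$. Suppose that for some constants $C\ge1$ and $\varepsilon_0>0$: (i) $g$ is $(C,\varepsilon_0)$-quasi inwardly increasing (near the boundary) in $\Omega$; (ii) every positive solution $u$ of the equation satisfies $g(x,u(x))\le C\,\delta(x)^{-2}\,u(x)$ in $\Omega$. Then there is a real $\bar c>0$ such that for every closed subset $F$ of $\partial\Omega$ and every nonnegative solution $u$ of the equation in $\Omega$ that vanishes on $\partial\Omega\setminus F$, $$g(x,u(x))\le\frac{\bar c}{d(x,F)^2}\,u(x),\qquad x\in\Omega.$$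
   Context: $\delta(x)=\mathrm{dist}(x,\mathbb R^N\setminus\Omega)$, $\mathbb R_+=[0,\infty)$, $d(x,F)$ is the distance from $x$ to $F$, and $\Omega(\varepsilon)=\{x\in\Omega:\delta(x)<\varepsilon\}$ for $\varepsilon>0$. A nonnegative function $u$ in $\Omega$ is a solution if $u$ and $g(\cdot,u(\cdot))$ are in $L^1_{loc}(\Omega)$ and $\Delta u=g(\cdot,u(\cdot))$ in the sense of distributions (such $u$ is taken to be continuous). "Vanishes on $\partial\Omega\setminus F$" means $u$ tends to $0$ at each point of $\partial\Omega\setminus F$. For $C\ge1$, $\varepsilon_0>0$, $g$ is $(C,\varepsilon_0)$-quasi inwardly increasing (near the boundary) in $\Omega$ if whenever $x\in\Omega(\varepsilon_0)$, $0<r<\varepsilon_0$ and $a>0$, one has $g(x,a)\le C\,g(x',Ca)$ for at least one point $x'\in\{z\in\mathbb R^N:|z-x|=r,\ \delta(z)\ge\varepsilon_0r\}$. *)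

theory Defs
  imports "HOL-Analysis.Analysis"
begin

text \<open>
  The space \<open>\<real>\<^sup>N\<close> is an arbitrary type of class \<^class>\<open>euclidean_space\<close>.
  Functions on an open set \<open>\<Omega>\<close> are total functions whose values off \<open>\<Omega>\<close> are irrelevant;
  likewise \<open>g x t\<close> only matters for \<open>x \<in> \<Omega>\<close> and \<open>t \<ge> 0\<close>.
\<close>

text \<open>
  Near each boundary point, \<open>\<Omega>\<close> is the part lying above the graph of a Lipschitz function of the
  variables orthogonal to some unit direction \<open>e\<close>.
\<close>

definition lipschitz_domain :: "'a::euclidean_space set \<Rightarrow> bool" where
  "lipschitz_domain \<Omega> \<longleftrightarrow>
     \<Omega> \<noteq> {} \<and> open \<Omega> \<and> connected \<Omega> \<and>
     (\<forall>z\<in>frontier \<Omega>. \<exists>r>0. \<exists>e. \<exists>\<phi> :: 'a \<Rightarrow> real. \<exists>L.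
        norm e = 1 \<and> L-lipschitz_on {y. y \<bullet> e = 0} \<phi> \<and>
        \<Omega> \<inter> ball z r = {x \<in> ball z r. \<phi> (x - (x \<bullet> e) *\<^sub>R e) < x \<bullet> e})"

definition bdist :: "'a::euclidean_space set \<Rightarrow> 'a \<Rightarrow> real" where
  "bdist \<Omega> x = infdist x (- \<Omega>)"

definition near_boundary :: "'a::euclidean_space set \<Rightarrow> real \<Rightarrow> 'a set" where
  "near_boundary \<Omega> \<epsilon> = {x \<in> \<Omega>. bdist \<Omega> x < \<epsilon>}"

text \<open>The point \<open>z\<close> below automatically lies in \<open>\<Omega>\<close>, since \<^const>\<open>bdist\<close> vanishes off \<open>\<Omega>\<close>.\<close>

definition quasi_inwardly_increasing ::
  "real \<Rightarrow> real \<Rightarrow> 'a::euclidean_space set \<Rightarrow> ('a \<Rightarrow> real \<Rightarrow> real) \<Rightarrow> bool" where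
  "quasi_inwardly_increasing C \<epsilon> \<Omega> g \<longleftrightarrow>
     (\<forall>x\<in>near_boundary \<Omega> \<epsilon>. \<forall>r a. 0 < r \<and> r < \<epsilon> \<and> 0 < a \<longrightarrow>
        (\<exists>z. dist z x = r \<and> bdist \<Omega> z \<ge> \<epsilon> * r \<and> g x a \<le> C * g z (C * a)))"

definition partial_deriv :: "'a::euclidean_space \<Rightarrow> ('a \<Rightarrow> real) \<Rightarrow> 'a \<Rightarrow> real" where
  "partial_deriv i f x = frechet_derivative f (at x) i"

fun Ck :: "nat \<Rightarrow> ('a::euclidean_space \<Rightarrow> real) \<Rightarrow> bool" where
  "Ck 0 f \<longleftrightarrow> continuous_on UNIV f"
| "Ck (Suc k) f \<longleftrightarrow> (\<forall>x. f differentiable (at x)) \<and> (\<forall>i\<in>Basis. Ck k (partial_deriv i f))"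

definition test_function :: "'a::euclidean_space set \<Rightarrow> ('a \<Rightarrow> real) \<Rightarrow> bool" where
  "test_function \<Omega> \<phi> \<longleftrightarrow>
     (\<forall>k. Ck k \<phi>) \<and> compact (closure {x. \<phi> x \<noteq> 0}) \<and> closure {x. \<phi> x \<noteq> 0} \<subseteq> \<Omega>"

definition laplacian :: "('a::euclidean_space \<Rightarrow> real) \<Rightarrow> 'a \<Rightarrow> real" where
  "laplacian \<phi> x = (\<Sum>i\<in>Basis. partial_deriv i (partial_deriv i \<phi>) x)"

definition L1_loc :: "'a::euclidean_space set \<Rightarrow> ('a \<Rightarrow> real) \<Rightarrow> bool" where
  "L1_loc \<Omega> f \<longleftrightarrow> (\<forall>K. compact K \<and> K \<subseteq> \<Omega> \<longrightarrow> set_integrable lebesgue K f)"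

text \<open>
  Distributional solutions are only determined almost everywhere; continuity selects the
  representative for which pointwise statements make sense.
\<close>

definition nonneg_solution ::
  "'a::euclidean_space set \<Rightarrow> ('a \<Rightarrow> real \<Rightarrow> real) \<Rightarrow> ('a \<Rightarrow> real) \<Rightarrow> bool" where
  "nonneg_solution \<Omega> g u \<longleftrightarrow>
     (\<forall>x\<in>\<Omega>. 0 \<le> u x) \<and> continuous_on \<Omega> u \<and>
     L1_loc \<Omega> u \<and> L1_loc \<Omega> (\<lambda>x. g x (u x)) \<and>
     (\<forall>\<phi>. test_function \<Omega> \<phi> \<longrightarrow>
        (LINT x:\<Omega>|lebesgue. u x * laplacian \<phi> x) = (LINT x:\<Omega>|lebesgue. g x (u x) * \<phi> x))"

definition positive_solution ::
  "'a::euclidean_space set \<Rightarrow> ('a \<Rightarrow> real \<Rightarrow> real) \<Rightarrow> ('a \<Rightarrow> real) \<Rightarrow> bool" where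
  "positive_solution \<Omega> g u \<longleftrightarrow> nonneg_solution \<Omega> g u \<and> (\<forall>x\<in>\<Omega>. 0 < u x)"

definition vanishes_on :: "'a::euclidean_space set \<Rightarrow> ('a \<Rightarrow> real) \<Rightarrow> 'a set \<Rightarrow> bool" where
  "vanishes_on \<Omega> u S \<longleftrightarrow> (\<forall>z\<in>S. (u \<longlongrightarrow> 0) (at z within \<Omega>))"

text \<open>
  For \<open>F = {}\<close> the bound \<open>c / d(x, F)\<^sup>2 * u x\<close> is \<open>0\<close>, as with the convention \<open>d(x, {}) = \<infinity>\<close>:
  \<^const>\<open>infdist\<close> is then \<open>0\<close>, and so is a quotient by \<open>0\<close>. For nonempty closed
  \<open>F \<subseteq> frontier \<Omega>\<close> and \<open>x \<in> \<Omega>\<close> with \<open>\<Omega>\<close> open, the distance is positive.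
\<close>

lemma infdist_pos_of_closed_frontier:
  assumes "open \<Omega>" "x \<in> \<Omega>" "closed F" "F \<noteq> {}" "F \<subseteq> frontier \<Omega>"
  shows "0 < infdist x F"
proof -
  have "x \<notin> F"
    using assms by (auto simp: frontier_def interior_open)
  then show ?thesis
    using assms infdist_pos_not_in_closed by blast
qed

end

theory Submission
  imports Defs
begin

text \<open>
  Write \<open>\<delta>\<close> for the distance to the complement of \<open>\<Omega>\<close>, and \<open>d\<close> for the distance from \<open>x\<close> to \<open>F\<close>.
  If \<open>\<delta> x\<close> is comparable to \<open>d\<close>, the claim is hypothesis (ii). If \<open>\<delta> x\<close> is much smaller than \<open>d\<close>,
  quasi inward monotonicity with \<open>r = c\<^sub>1 d\<close> gives a point \<open>z\<close> at distance \<open>r\<close> from \<open>x\<close> and at depth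
  at least \<open>\<epsilon>\<^sub>0 r\<close> with \<open>g x (u x) \<le> C * g z (C * u x)\<close>. As soon as \<open>C * u x \<le> u z\<close>, the
  monotonicity of \<open>g z t / t\<close> replaces \<open>g z (C * u x)\<close> by \<open>C * u x * (g z (u z) / u z)\<close>, and (ii)
  at \<open>z\<close> bounds this by a multiple of \<open>u x / r\<^sup>2\<close>. So everything reduces to showing that \<open>u x\<close> is a small
  multiple of \<open>u z\<close> when \<open>\<delta> x\<close> is a small multiple of \<open>d\<close> (\<open>small_near_boundary\<close>). Near \<open>x\<close> the
  solution vanishes on the boundary, and three facts about \<open>u\<close> combine.

  Harnack inequality (\<open>harnack\<close>, \<open>solution_harnack\<close>). By (ii), \<open>\<Delta>u = V u\<close> with \<open>0 \<le> V \<le> C / \<delta>\<^sup>2\<close>. Testing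
  the equation against an explicit family of radial functions \<open>pot x r\<close>, whose Laplacian is the
  derivative in \<open>r\<close> of a weight \<open>kern x r\<close> of constant mass, shows that the weighted mean of \<open>u\<close>
  increases with \<open>r\<close>, but at most by a bounded factor as long as \<open>r\<close> is comparable to \<open>\<delta> x\<close>. Hence \<open>u\<close> is
  comparable to its own means from both sides. The same monotonicity yields the maximum principle
  and, on the connected set \<open>\<Omega>\<close>, the alternative \<open>u = 0\<close> or \<open>u > 0\<close>.

  Decay (\<open>decay\<close>). Since \<open>u\<close> is subharmonic and below each boundary point there is a ball outside \<open>\<Omega>\<close>
  of proportional radius, comparison with a Gaussian barrier gives
  \<open>sup u \<le> \<theta> * sup u\<close> with \<open>\<theta> < 1\<close>, the left side over a ball of radius \<open>t\<close>, the right side over the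
  concentric ball of radius \<open>6 t\<close>; iteration gives a power of the distance to the boundary.

  Carleson estimate (\<open>carleson\<close>): \<open>u \<le> B * u z\<close> on a ball around \<open>x\<close> of radius comparable to \<open>r\<close>. Chains of
  Harnack balls bound \<open>u\<close> at \<open>y\<close> by a negative power \<open>-p\<close> of the height of \<open>y\<close> over the boundary graph. The
  maximum of \<open>u y * (r - dist x y) ^ p\<close> cannot be attained where the height is small compared to
  \<open>r - dist x y\<close>, because there the decay would beat the weight; elsewhere the chain bound applies.

  Applying the decay once more, starting from the Carleson bound, makes \<open>u x / u z\<close> as small as required.
\<close>

section \<open>An algebra of smooth functions\<close>

text \<open>
  The classical flat function \<open>exp (- 1 / t)\<close> with arbitrary negative powers of \<open>t\<close> in front; the family
  in \<open>n\<close> is closed under differentiation up to linear combinations.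
\<close>

definition flat_exp :: "nat \<Rightarrow> real \<Rightarrow> real" where
  "flat_exp n t = (if 0 < t then inverse t ^ n * exp (- inverse t) else 0)"

lemma flat_exp_tendsto_0: "(flat_exp n \<longlongrightarrow> 0) (at_right 0)"
proof -
  have "((\<lambda>t. (inverse t) ^ n / exp (inverse t)) \<longlongrightarrow> 0) (at_right (0::real))"
    by (rule filterlim_compose[OF tendsto_power_div_exp_0 filterlim_inverse_at_top_right])
  then show ?thesis
    by (rule Lim_transform_eventually)
       (auto simp: flat_exp_def exp_minus divide_inverse eventually_at_right_field intro!: exI[of _ 1])
qed

lemma flat_exp_has_derivative:
  "(flat_exp n has_real_derivative flat_exp (n + 2) t - n * flat_exp (n + 1) t) (at t)"
proof -
  consider "t > 0" | "t < 0" | "t = 0" by linarith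
  then show ?thesis
  proof cases
    case 1
    have "real n * (inverse t ^ (n - 1) * (inverse t)\<^sup>2) = n * inverse t ^ (n + 1)"
      by (cases n) (auto simp: power2_eq_square)
    moreover have "((\<lambda>t. inverse t ^ n * exp (- inverse t)) has_real_derivative
        - (real n * (inverse t ^ (n - 1) * (inverse t)\<^sup>2)) * exp (- inverse t)
        + inverse t ^ n * (exp (- inverse t) * (inverse t)\<^sup>2)) (at t)"
      using 1 by (auto intro!: derivative_eq_intros simp: power2_eq_square)
    ultimately have "((\<lambda>t. inverse t ^ n * exp (- inverse t)) has_real_derivative
        - (n * inverse t ^ (n + 1)) * exp (- inverse t)
        + inverse t ^ n * (exp (- inverse t) * (inverse t)\<^sup>2)) (at t)"
      by (simp only:)
    then have "((\<lambda>t. inverse t ^ n * exp (- inverse t)) has_real_derivative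
        flat_exp (n + 2) t - n * flat_exp (n + 1) t) (at t)"
      by (rule DERIV_cong) (use 1 in \<open>simp add: flat_exp_def power_add power2_eq_square\<close>)
    then show ?thesis
      by (rule has_field_derivative_transform_within_open[of _ _ _ "{0<..}"])
         (use 1 in \<open>auto simp: flat_exp_def\<close>)
  next
    case 2
    have "((\<lambda>t. 0) has_real_derivative flat_exp (n + 2) t - n * flat_exp (n + 1) t) (at t)"
      using 2 by (auto simp: flat_exp_def)
    then show ?thesis
      by (rule has_field_derivative_transform_within_open[of _ _ _ "{..<0}"])
         (use 2 in \<open>auto simp: flat_exp_def\<close>)
  next
    case 3
    have "((\<lambda>h. flat_exp n h / h) \<longlongrightarrow> 0) (at 0)"
      unfolding filterlim_at_split
    proof
      show "((\<lambda>h. flat_exp n h / h) \<longlongrightarrow> 0) (at_left 0)"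
        by (rule Lim_transform_eventually[OF tendsto_const])
           (auto simp: flat_exp_def eventually_at_left_field intro!: exI[of _ "-1"])
      show "((\<lambda>h. flat_exp n h / h) \<longlongrightarrow> 0) (at_right 0)"
        by (rule Lim_transform_eventually[OF flat_exp_tendsto_0[of "n + 1"]])
           (auto simp: flat_exp_def eventually_at_right_field field_simps intro!: exI[of _ 1])
    qed
    then show ?thesis
      using 3 by (simp add: DERIV_def flat_exp_def)
  qed
qed

lemma flat_exp_nonneg: "0 \<le> flat_exp n t"
  by (simp add: flat_exp_def)

lemma flat_exp_pos: "0 < t \<Longrightarrow> 0 < flat_exp n t"
  by (simp add: flat_exp_def)

lemma flat_exp_eq_0: "t \<le> 0 \<Longrightarrow> flat_exp n t = 0"
  by (simp add: flat_exp_def)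

text \<open>
  For the profile \<open>exp (- 1 / t)\<close> the function itself is dominated by its derivative on \<open>t \<le> 1\<close>. This is
  what bounds the potential \<open>pot\<close> by the kernel \<open>kern\<close> below, and thereby turns the
  mean value identity into a differential inequality.
\<close>

lemma flat_exp_0_le_2: "t \<le> 1 \<Longrightarrow> flat_exp 0 t \<le> flat_exp 2 t"
  by (auto simp: flat_exp_def intro!: one_le_inverse one_le_power)

lemma flat_exp_2_le: "flat_exp 2 t \<le> 2"
proof (cases "0 < t")
  case True
  have "1 + inverse t + (inverse t)\<^sup>2 / 2 \<le> exp (inverse t)"
    using True by (intro exp_lower_Taylor_quadratic) auto
  then have "(inverse t)\<^sup>2 \<le> 2 * exp (inverse t)"
    using True by (smt (verit) inverse_positive_iff_positive field_sum_of_halves)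
  then show ?thesis using True by (simp add: flat_exp_def exp_minus field_simps)
qed (simp add: flat_exp_def)

text \<open>
  A set of functions that is closed under partial derivatives consists of functions that are
  differentiable to all orders; this inductive set contains all the test functions and barriers
  that occur.
\<close>

inductive elem_smooth :: "('a::euclidean_space \<Rightarrow> real) \<Rightarrow> bool" where
  const: "elem_smooth (\<lambda>x. c)"
| inner: "elem_smooth (\<lambda>x. x \<bullet> b)"
| sq_dist: "elem_smooth (\<lambda>x. (norm (x - a))\<^sup>2)"
| add: "elem_smooth f \<Longrightarrow> elem_smooth g \<Longrightarrow> elem_smooth (\<lambda>x. f x + g x)"
| mult: "elem_smooth f \<Longrightarrow> elem_smooth g \<Longrightarrow> elem_smooth (\<lambda>x. f x * g x)"
| exp: "elem_smooth f \<Longrightarrow> elem_smooth (\<lambda>x. exp (f x))"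
| flat_exp: "elem_smooth f \<Longrightarrow> elem_smooth (\<lambda>x. flat_exp n (f x))"

lemma elem_smooth_minus: "elem_smooth f \<Longrightarrow> elem_smooth g \<Longrightarrow> elem_smooth (\<lambda>x. f x - g x)"
  using elem_smooth.add[of f "\<lambda>x. (-1) * g x"] elem_smooth.mult[OF elem_smooth.const[of "-1"], of g]
  by simp

lemma partial_deriv_eq:
  "(f has_derivative f') (at x) \<Longrightarrow> partial_deriv i f x = f' i"
  by (simp add: partial_deriv_def frechet_derivative_at[symmetric])

lemma elem_smooth_deriv:
  assumes "elem_smooth f"
  shows "\<exists>f'. (\<forall>x. (f has_derivative f' x) (at x)) \<and> (\<forall>i. elem_smooth (\<lambda>x. f' x i))"
  using assms
proof induction
  case (const c)
  then show ?case
    by (intro exI[of _ "\<lambda>x i. 0"]) (auto intro: elem_smooth.const)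
next
  case (inner b)
  then show ?case
    by (intro exI[of _ "\<lambda>x i. i \<bullet> b"]) (auto intro: elem_smooth.const intro!: derivative_eq_intros)
next
  case (sq_dist a)
  have "elem_smooth (\<lambda>x. 2 * (x \<bullet> i + (- (a \<bullet> i))))" for i :: 'a
    by (intro elem_smooth.intros)
  then have "elem_smooth (\<lambda>x. 2 * ((x - a) \<bullet> i))" for i :: 'a
    by (simp add: inner_diff_left)
  then show ?case
    unfolding power2_norm_eq_inner
    by (intro exI[of _ "\<lambda>x i. 2 * ((x - a) \<bullet> i)"])
       (auto simp: inner_diff_left inner_diff_right inner_commute intro!: derivative_eq_intros)
next
  case (add f g)
  then obtain f' g' where "\<forall>x. (f has_derivative f' x) (at x)" "\<forall>i. elem_smooth (\<lambda>x. f' x i)"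
    "\<forall>x. (g has_derivative g' x) (at x)" "\<forall>i. elem_smooth (\<lambda>x. g' x i)" by blast
  then show ?case
    by (intro exI[of _ "\<lambda>x i. f' x i + g' x i"]) (auto intro!: derivative_eq_intros elem_smooth.add)
next
  case (mult f g)
  then obtain f' g' where "\<forall>x. (f has_derivative f' x) (at x)" "\<forall>i. elem_smooth (\<lambda>x. f' x i)"
    "\<forall>x. (g has_derivative g' x) (at x)" "\<forall>i. elem_smooth (\<lambda>x. g' x i)" by blast
  with mult(1,2) show ?case
    by (intro exI[of _ "\<lambda>x i. f x * g' x i + f' x i * g x"])
       (auto intro!: has_derivative_mult elem_smooth.add elem_smooth.mult)
next
  case (exp f)
  then obtain f' where f': "\<forall>x. (f has_derivative f' x) (at x)" "\<forall>i. elem_smooth (\<lambda>x. f' x i)" by blast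
  then have "((\<lambda>x. exp (f x)) has_derivative (\<lambda>i. exp (f x) * f' x i)) (at x)" for x
    by (auto intro!: derivative_eq_intros simp: mult.commute)
  with exp(1) f' show ?case
    by (intro exI[of _ "\<lambda>x i. exp (f x) * f' x i"]) (auto intro!: elem_smooth.mult elem_smooth.exp)
next
  case (flat_exp f n)
  then obtain f' where f': "\<forall>x. (f has_derivative f' x) (at x)" "\<forall>i. elem_smooth (\<lambda>x. f' x i)" by blast
  have "((\<lambda>x. flat_exp n (f x)) has_derivative
      (\<lambda>i. (flat_exp (n + 2) (f x) - n * flat_exp (n + 1) (f x)) * f' x i)) (at x)" for x
    using has_derivative_compose[OF f'(1)[rule_format]
      flat_exp_has_derivative[unfolded has_field_derivative_def]] .
  with flat_exp(1) f' show ?case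
    by (intro exI[of _ "\<lambda>x i. (flat_exp (n + 2) (f x) - n * flat_exp (n + 1) (f x)) * f' x i"])
       (auto intro!: elem_smooth.intros elem_smooth_minus)
qed

lemma elem_smooth_differentiable: "elem_smooth f \<Longrightarrow> f differentiable (at x)"
  using elem_smooth_deriv[of f] by (auto simp: differentiable_def)

lemma elem_smooth_has_derivative:
  assumes "elem_smooth f"
  shows "(f has_derivative (\<lambda>i. partial_deriv i f x)) (at x)"
  using elem_smooth_differentiable[OF assms, of x]
  by (simp add: partial_deriv_def frechet_derivative_works)

lemma elem_smooth_partial_deriv:
  assumes "elem_smooth f"
  shows "elem_smooth (partial_deriv i f)"
proof -
  obtain f' where f': "\<forall>x. (f has_derivative f' x) (at x)" "\<forall>i. elem_smooth (\<lambda>x. f' x i)"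
    using elem_smooth_deriv[OF assms] by blast
  then have "partial_deriv i f = (\<lambda>x. f' x i)"
    by (auto simp: partial_deriv_eq)
  with f' show ?thesis by simp
qed

lemma elem_smooth_continuous: "elem_smooth f \<Longrightarrow> continuous_on S f"
  by (meson continuous_at_imp_continuous_on differentiable_imp_continuous_within elem_smooth_differentiable)

lemma elem_smooth_Ck: "elem_smooth f \<Longrightarrow> Ck k f"
  by (induction k arbitrary: f)
     (auto intro: elem_smooth_continuous elem_smooth_differentiable elem_smooth_partial_deriv)

lemma elem_smooth_sum:
  "finite I \<Longrightarrow> (\<And>i. i \<in> I \<Longrightarrow> elem_smooth (f i)) \<Longrightarrow> elem_smooth (\<lambda>x. \<Sum>i\<in>I. f i x)"
  by (induction rule: finite_induct) (auto intro: elem_smooth.intros)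

lemma elem_smooth_laplacian: "elem_smooth f \<Longrightarrow> elem_smooth (laplacian f)"
  unfolding laplacian_def[abs_def]
  by (intro elem_smooth_sum elem_smooth_partial_deriv) auto

section \<open>Integration by parts\<close>

lemma integrable_compact_support:
  fixes F :: "'a::euclidean_space \<Rightarrow> real"
  assumes "compact S" "continuous_on S F" "\<And>x. x \<notin> S \<Longrightarrow> F x = 0"
  shows "integrable lborel F"
proof -
  have "(\<lambda>x. indicator S x *\<^sub>R F x) = F"
    using assms(3) by (auto simp: fun_eq_iff indicator_def)
  then show ?thesis
    using borel_integrable_compact[OF assms(1,2)] by simp
qed

lemma partial_deriv_support:
  assumes "\<And>z. z \<notin> cball a \<rho> \<Longrightarrow> F z = 0" "x \<notin> cball a \<rho>"
  shows "partial_deriv i F x = 0"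
proof -
  have "((\<lambda>z. 0) has_derivative (\<lambda>i. 0)) (at x)" by simp
  then have "(F has_derivative (\<lambda>i. 0)) (at x)"
    by (rule has_derivative_transform_within_open[of _ _ _ _ "- cball a \<rho>"]) (use assms in auto)
  then show ?thesis by (simp add: partial_deriv_eq)
qed

text \<open>
  By translation invariance every difference quotient of \<open>F\<close> has integral \<open>0\<close>; the difference quotients
  are uniformly bounded with common bounded support, so the limit may be taken under the integral.
\<close>

lemma integral_partial_deriv_eq_0:
  fixes F :: "'a::euclidean_space \<Rightarrow> real"
  assumes F: "elem_smooth F" and supp: "\<And>x. x \<notin> cball a \<rho> \<Longrightarrow> F x = 0" and i: "i \<in> Basis"
  shows "(\<integral>x. partial_deriv i F x \<partial>lborel) = 0"
proof -
  define h :: "nat \<Rightarrow> real" where "h n = inverse (real (Suc n))" for n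
  have h: "0 < h n" "h n \<le> 1" for n
    by (auto simp: h_def field_simps)
  define D where "D n x = (F (x + h n *\<^sub>R i) - F x) / h n" for n x
  have norm_i: "norm i = 1" using i by simp
  have line: "((\<lambda>t. F (x + t *\<^sub>R i)) has_real_derivative partial_deriv i F (x + t *\<^sub>R i)) (at t)" for x t
  proof -
    have "((\<lambda>t. x + t *\<^sub>R i) has_derivative (\<lambda>s. s *\<^sub>R i)) (at t)"
      by (auto intro!: derivative_eq_intros)
    from has_derivative_compose[OF this elem_smooth_has_derivative[OF F]]
    have *: "((\<lambda>t. F (x + t *\<^sub>R i)) has_derivative
        (\<lambda>s. partial_deriv (s *\<^sub>R i) F (x + t *\<^sub>R i))) (at t)" .
    have "linear (\<lambda>j. partial_deriv j F y)" for y
      using elem_smooth_has_derivative[OF F] has_derivative_linear by blast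
    then have "partial_deriv (s *\<^sub>R i) F y = partial_deriv i F y * s" for s y
      using linear_cmul[of "\<lambda>j. partial_deriv j F y" s i] by (simp add: mult.commute)
    with * show ?thesis
      by (simp add: has_field_derivative_def)
  qed
  have cont: "continuous_on S F" "continuous_on S (partial_deriv i F)" for S
    using F by (auto intro: elem_smooth_continuous elem_smooth_partial_deriv)
  have supp': "partial_deriv i F x = 0" if "x \<notin> cball a \<rho>" for x
    using partial_deriv_support[OF supp that] .
  have "bounded (partial_deriv i F ` cball a \<rho>)"
    by (intro compact_imp_bounded compact_continuous_image cont) auto
  then obtain M where "\<And>x. x \<in> cball a \<rho> \<Longrightarrow> \<bar>partial_deriv i F x\<bar> \<le> M"
    unfolding bounded_iff by (metis imageI real_norm_def)
  then have M: "\<bar>partial_deriv i F x\<bar> \<le> max M 0" for x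
    using supp'[of x] by (cases "x \<in> cball a \<rho>") (force simp del: mem_cball)+
  have int_F: "integrable lborel F"
    using cont supp by (intro integrable_compact_support[of "cball a \<rho>"]) auto
  have int0: "(\<integral>x. D n x \<partial>lborel) = 0" for n
  proof -
    have "(\<integral>x. F (h n *\<^sub>R i + x) \<partial>lborel) = (\<integral>x. F x \<partial>distr lborel borel ((+) (h n *\<^sub>R i)))"
      by (intro integral_distr[symmetric]) (auto intro: borel_measurable_continuous_onI cont)
    also have "\<dots> = (\<integral>x. F x \<partial>lborel)" by (simp add: lborel_distr_plus)
    finally have 1: "(\<integral>x. F (x + h n *\<^sub>R i) \<partial>lborel) = (\<integral>x. F x \<partial>lborel)"
      by (simp add: add.commute)
    have "integrable (distr lborel borel ((+) (h n *\<^sub>R i))) F"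
      using int_F by (simp add: lborel_distr_plus)
    then have "integrable lborel (\<lambda>x. F (h n *\<^sub>R i + x))"
      by (subst (asm) integrable_distr_eq) (auto intro: borel_measurable_continuous_onI cont)
    then have "integrable lborel (\<lambda>x. F (x + h n *\<^sub>R i))" by (simp add: add.commute)
    with 1 int_F show ?thesis by (simp add: D_def)
  qed
  have "(\<lambda>n. \<integral>x. D n x \<partial>lborel) \<longlonglongrightarrow> (\<integral>x. partial_deriv i F x \<partial>lborel)"
  proof (rule integral_dominated_convergence)
    show "integrable lborel (\<lambda>x. max M 0 * indicator (cball a (\<rho> + 1)) x)"
      by (intro integrable_mult_right integrable_real_indicator emeasure_bounded_finite) auto
    show "AE x in lborel. (\<lambda>n. D n x) \<longlonglongrightarrow> partial_deriv i F x"
    proof (rule AE_I2)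
      fix x
      have "((\<lambda>t. (F (x + t *\<^sub>R i) - F x) / t) \<longlongrightarrow> partial_deriv i F x) (at 0)"
        using line[of x 0] by (simp add: DERIV_def)
      moreover have "filterlim h (at 0) sequentially"
        unfolding filterlim_at using LIMSEQ_inverse_real_of_nat h(1)
        by (auto simp: h_def[abs_def] less_imp_neq)
      ultimately show "(\<lambda>n. D n x) \<longlonglongrightarrow> partial_deriv i F x"
        unfolding D_def by (rule filterlim_compose)
    qed
    show "AE x in lborel. norm (D n x) \<le> max M 0 * indicator (cball a (\<rho> + 1)) x" for n
    proof (rule AE_I2)
      fix x
      show "norm (D n x) \<le> max M 0 * indicator (cball a (\<rho> + 1)) x"
      proof (cases "x \<in> cball a (\<rho> + 1)")
        case True
        obtain t where "F (x + h n *\<^sub>R i) - F (x + 0 *\<^sub>R i) = (h n - 0) * partial_deriv i F (x + t *\<^sub>R i)"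
          using MVT2[OF h(1)[of n], OF line] by blast
        then have "D n x = partial_deriv i F (x + t *\<^sub>R i)"
          using h(1)[of n] by (simp add: D_def)
        with M True show ?thesis by simp
      next
        case False
        have "x + h n *\<^sub>R i \<notin> cball a \<rho>"
        proof
          assume "x + h n *\<^sub>R i \<in> cball a \<rho>"
          moreover have "dist a x \<le> dist a (x + h n *\<^sub>R i) + dist (x + h n *\<^sub>R i) x"
            by (rule dist_triangle)
          moreover have "dist (x + h n *\<^sub>R i) x = h n"
            using norm_i h(1)[of n] by (simp add: dist_norm)
          ultimately show False using False h(2)[of n] by auto
        qed
        with False supp show ?thesis by (simp add: D_def)
      qed
    qed
    show "partial_deriv i F \<in> borel_measurable lborel"
      by (auto intro: borel_measurable_continuous_onI cont)
    show "D n \<in> borel_measurable lborel" for n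
    proof -
      have "continuous_on UNIV (D n)"
        unfolding D_def using h(1)[of n]
        by (intro continuous_intros continuous_on_compose2[OF cont(1)[of UNIV]]) auto
      then show ?thesis by (simp add: borel_measurable_continuous_onI)
    qed
  qed
  then show ?thesis
    by (simp add: int0 LIMSEQ_const_iff)
qed

lemma partial_deriv_mult:
  assumes "elem_smooth f" "elem_smooth g"
  shows "partial_deriv i (\<lambda>x. f x * g x) x = f x * partial_deriv i g x + partial_deriv i f x * g x"
  by (rule partial_deriv_eq[OF has_derivative_mult[OF elem_smooth_has_derivative elem_smooth_has_derivative]])
    fact+

lemma partial_deriv_diff:
  assumes "elem_smooth f" "elem_smooth g"
  shows "partial_deriv i (\<lambda>x. f x - g x) x = partial_deriv i f x - partial_deriv i g x"
  by (rule partial_deriv_eq[OF has_derivative_diff[OF elem_smooth_has_derivative elem_smooth_has_derivative]])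
    fact+

lemma laplacian_support:
  assumes "\<And>z. z \<notin> cball a \<rho> \<Longrightarrow> F z = 0" "x \<notin> cball a \<rho>"
  shows "laplacian F x = 0"
  unfolding laplacian_def
  by (intro sum.neutral ballI partial_deriv_support[of a \<rho>] assms)

text \<open>
  The difference of the two integrands is the divergence of \<open>w \<nabla>\<Phi> - \<Phi> \<nabla>w\<close>.
\<close>

lemma green_identity:
  fixes w \<Phi> :: "'a::euclidean_space \<Rightarrow> real"
  assumes w: "elem_smooth w" and \<Phi>: "elem_smooth \<Phi>"
    and supp: "\<And>x. x \<notin> cball a \<rho> \<Longrightarrow> \<Phi> x = 0"
  shows "(\<integral>x. w x * laplacian \<Phi> x \<partial>lborel) = (\<integral>x. laplacian w x * \<Phi> x \<partial>lborel)"
proof -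
  define F where "F i x = w x * partial_deriv i \<Phi> x - \<Phi> x * partial_deriv i w x" for i x
  have F: "elem_smooth (F i)" for i
    unfolding F_def by (intro elem_smooth_minus elem_smooth.mult elem_smooth_partial_deriv w \<Phi>)
  have supp_F: "F i x = 0" if "x \<notin> cball a \<rho>" for i x
    using supp[OF that] partial_deriv_support[OF supp that] by (simp add: F_def)
  have dF: "partial_deriv i (F i) x =
      w x * partial_deriv i (partial_deriv i \<Phi>) x - partial_deriv i (partial_deriv i w) x * \<Phi> x" for i x
    unfolding F_def using w \<Phi>
    by (subst partial_deriv_diff)
       (auto simp: partial_deriv_mult elem_smooth_partial_deriv algebra_simps intro!: elem_smooth.mult)
  have int: "integrable lborel (partial_deriv i (F i))" for i
    using elem_smooth_continuous[OF elem_smooth_partial_deriv[OF F]] partial_deriv_support[OF supp_F]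
    by (intro integrable_compact_support[of "cball a \<rho>"]) auto
  have int1: "integrable lborel (\<lambda>x. w x * laplacian \<Phi> x)"
    using laplacian_support[of a \<rho> \<Phi>, OF supp] w \<Phi>
    by (intro integrable_compact_support[of "cball a \<rho>"] continuous_intros elem_smooth_continuous
        elem_smooth_laplacian) (auto simp del: mem_cball)
  have int2: "integrable lborel (\<lambda>x. laplacian w x * \<Phi> x)"
    using supp w \<Phi>
    by (intro integrable_compact_support[of "cball a \<rho>"] continuous_intros elem_smooth_continuous
        elem_smooth_laplacian) auto
  have "(\<integral>x. w x * laplacian \<Phi> x \<partial>lborel) - (\<integral>x. laplacian w x * \<Phi> x \<partial>lborel) =
      (\<integral>x. (\<Sum>i\<in>Basis. partial_deriv i (F i) x) \<partial>lborel)"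
    unfolding Bochner_Integration.integral_diff[OF int1 int2, symmetric] dF
    by (simp add: laplacian_def sum_subtractf sum_distrib_left sum_distrib_right)
  also have "\<dots> = (\<Sum>i\<in>Basis. \<integral>x. partial_deriv i (F i) x \<partial>lborel)"
    by (intro Bochner_Integration.integral_sum int)
  also have "\<dots> = 0"
    by (intro sum.neutral ballI integral_partial_deriv_eq_0[OF F supp_F])
  finally show ?thesis by simp
qed

section \<open>Radial kernels\<close>

text \<open>
  With \<open>K s = exp (- 1 / (1 - s))\<close> for \<open>s < 1\<close>, continued by \<open>0\<close>, and \<open>N\<close> the dimension, \<open>pot x r z = r\<^sup>1\<^sup>-\<^sup>N K (|z - x|\<^sup>2 / r\<^sup>2)\<close> and
  \<open>kern x r z = - 2 r\<^sup>-\<^sup>N K' (|z - x|\<^sup>2 / r\<^sup>2)\<close>. They are matched so that the Laplacian of \<open>pot x r\<close> is the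
  derivative of \<open>kern x r\<close> with respect to \<open>r\<close>, while \<open>pot\<close> is at most \<open>r / 2\<close> times \<open>kern\<close>.
\<close>

definition pot :: "'a::euclidean_space \<Rightarrow> real \<Rightarrow> 'a \<Rightarrow> real" where
  "pot x r z = r / r ^ DIM('a) * flat_exp 0 (1 - (norm (z - x))\<^sup>2 / r\<^sup>2)"

definition kern :: "'a::euclidean_space \<Rightarrow> real \<Rightarrow> 'a \<Rightarrow> real" where
  "kern x r z = 2 / r ^ DIM('a) * flat_exp 2 (1 - (norm (z - x))\<^sup>2 / r\<^sup>2)"

lemma flat_exp_continuous: "continuous_on S (flat_exp n)"
  by (meson DERIV_isCont continuous_at_imp_continuous_on flat_exp_has_derivative)

lemma profile_nonpos:
  assumes "0 < r" "z \<notin> ball x r"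
  shows "1 - (norm (z - x))\<^sup>2 / r\<^sup>2 \<le> 0"
  using assms by (simp add: dist_norm norm_minus_commute)

lemma pot_support: "0 < r \<Longrightarrow> z \<notin> ball x r \<Longrightarrow> pot x r z = 0"
  using profile_nonpos[of r z x] by (simp add: pot_def flat_exp_eq_0 del: mem_ball)

lemma kern_support: "0 < r \<Longrightarrow> z \<notin> ball x r \<Longrightarrow> kern x r z = 0"
  using profile_nonpos[of r z x] by (simp add: kern_def flat_exp_eq_0 del: mem_ball)

lemma pot_nonneg: "0 < r \<Longrightarrow> 0 \<le> pot x r z"
  by (simp add: pot_def flat_exp_nonneg)

lemma kern_nonneg: "0 < r \<Longrightarrow> 0 \<le> kern x r z"
  by (simp add: kern_def flat_exp_nonneg)

lemma kern_pos: "0 < r \<Longrightarrow> z \<in> ball x r \<Longrightarrow> 0 < kern x r z"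
  unfolding kern_def
  by (intro mult_pos_pos flat_exp_pos)
     (auto simp: dist_norm norm_minus_commute power_strict_mono)

lemma pot_le_kern: "0 < r \<Longrightarrow> pot x r z \<le> r / 2 * kern x r z"
  using flat_exp_0_le_2[of "1 - (norm (z - x))\<^sup>2 / r\<^sup>2"]
  by (simp add: pot_def kern_def divide_right_mono mult_left_mono)

lemma profile_elem_smooth: "elem_smooth (\<lambda>z. 1 - (norm (z - x))\<^sup>2 / r\<^sup>2)"
proof -
  have "elem_smooth (\<lambda>z. 1 + (- 1 / r\<^sup>2) * (norm (z - x))\<^sup>2)"
    by (intro elem_smooth.intros)
  then show ?thesis by (simp add: field_simps)
qed

lemma pot_elem_smooth: "elem_smooth (pot x r)"
  unfolding pot_def[abs_def] by (intro elem_smooth.intros profile_elem_smooth)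

lemma kern_elem_smooth: "elem_smooth (kern x r)"
  unfolding kern_def[abs_def] by (intro elem_smooth.intros profile_elem_smooth)

lemma flat_exp_profile_has_derivative:
  fixes x :: "'a::euclidean_space"
  shows "((\<lambda>z. flat_exp n (1 - (norm (z - x))\<^sup>2 / r\<^sup>2)) has_derivative
      (\<lambda>i. (flat_exp (n + 2) (1 - (norm (z - x))\<^sup>2 / r\<^sup>2)
        - n * flat_exp (n + 1) (1 - (norm (z - x))\<^sup>2 / r\<^sup>2)) * (- 2 * ((z - x) \<bullet> i) / r\<^sup>2))) (at z)"
proof -
  have "((\<lambda>z. 1 - (norm (z - x))\<^sup>2 / r\<^sup>2) has_derivative (\<lambda>i. - 2 * ((z - x) \<bullet> i) / r\<^sup>2)) (at z)"
    unfolding power2_norm_eq_inner divide_inverse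
    by (auto intro!: derivative_eq_intros simp: inner_commute algebra_simps)
  from has_derivative_compose[OF this flat_exp_has_derivative[unfolded has_field_derivative_def]]
  show ?thesis .
qed

lemma laplacian_pot:
  fixes x :: "'a::euclidean_space"
  assumes r: "0 < r"
  defines "S \<equiv> \<lambda>z. 1 - (norm (z - x))\<^sup>2 / r\<^sup>2"
  shows "laplacian (pot x r) z = r / r ^ DIM('a) * ((flat_exp 4 (S z) - 2 * flat_exp 3 (S z))
     * (4 * (norm (z - x))\<^sup>2 / r ^ 4) - 2 * DIM('a) * flat_exp 2 (S z) / r\<^sup>2)"
proof -
  have 1: "partial_deriv i (pot x r) = (\<lambda>z. r / r ^ DIM('a) * (flat_exp 2 (S z) * (- 2 * ((z - x) \<bullet> i) / r\<^sup>2)))" for i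
  proof
    fix z
    have "(pot x r has_derivative (\<lambda>i. r / r ^ DIM('a) * (flat_exp 2 (S z) * (- 2 * ((z - x) \<bullet> i) / r\<^sup>2)))) (at z)"
      using has_derivative_mult_right[OF flat_exp_profile_has_derivative[of 0 x r z], of "r / r ^ DIM('a)"]
      by (simp add: pot_def[abs_def] S_def numeral_2_eq_2)
    then show "partial_deriv i (pot x r) z = r / r ^ DIM('a) * (flat_exp 2 (S z) * (- 2 * ((z - x) \<bullet> i) / r\<^sup>2))"
      by (rule partial_deriv_eq)
  qed
  have 2: "partial_deriv i (partial_deriv i (pot x r)) z = r / r ^ DIM('a) *
      ((flat_exp 4 (S z) - 2 * flat_exp 3 (S z)) * (4 * ((z - x) \<bullet> i)\<^sup>2 / r ^ 4) - 2 * flat_exp 2 (S z) / r\<^sup>2)"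
    if "i \<in> Basis" for i
  proof -
    have "((\<lambda>z. - 2 * ((z - x) \<bullet> i) / r\<^sup>2) has_derivative (\<lambda>j. - 2 * (j \<bullet> i) / r\<^sup>2)) (at z)"
      unfolding divide_inverse by (auto intro!: derivative_eq_intros)
    from has_derivative_mult_right[OF has_derivative_mult[OF flat_exp_profile_has_derivative[of 2 x r z] this],
       of "r / r ^ DIM('a)"]
    have "(partial_deriv i (pot x r) has_derivative (\<lambda>j. r / r ^ DIM('a) *
      (flat_exp 2 (S z) * (- 2 * (j \<bullet> i) / r\<^sup>2) +
       (flat_exp 4 (S z) - 2 * flat_exp 3 (S z)) * (- 2 * ((z - x) \<bullet> j) / r\<^sup>2) * (- 2 * ((z - x) \<bullet> i) / r\<^sup>2)))) (at z)"
      unfolding 1 S_def by simp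
    from partial_deriv_eq[OF this, of i] that show ?thesis
      by (simp add: power2_eq_square power4_eq_xxxx mult_ac)
  qed
  have "(norm (z - x))\<^sup>2 = (\<Sum>i\<in>Basis. ((z - x) \<bullet> i)\<^sup>2)"
    unfolding power2_norm_eq_inner by (subst euclidean_inner) (simp add: power2_eq_square)
  show ?thesis
    unfolding laplacian_def using 2 \<open>(norm (z - x))\<^sup>2 = _\<close>
    by (simp add: sum_distrib_left sum_divide_distrib sum_subtractf right_diff_distrib mult.assoc)
qed

text \<open>
  The identity behind all mean value properties: averages of \<open>v\<close> against \<open>kern x r\<close> change with \<open>r\<close> at the
  rate at which \<open>v\<close> is tested against the Laplacian of \<open>pot x r\<close>.
\<close>

lemma kern_has_derivative_radius:
  fixes x :: "'a::euclidean_space"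
  assumes r: "0 < r"
  shows "((\<lambda>r. kern x r z) has_real_derivative laplacian (pot x r) z) (at r)"
proof -
  define S where "S \<equiv> \<lambda>r. 1 - (norm (z - x))\<^sup>2 / r\<^sup>2"
  have "(S has_real_derivative 2 * (norm (z - x))\<^sup>2 / r ^ 3) (at r)"
    unfolding S_def using r
    by (auto intro!: derivative_eq_intros simp: field_simps power2_eq_square power3_eq_cube)
  from DERIV_chain2[OF flat_exp_has_derivative this, of 2]
  have 1: "((\<lambda>r. flat_exp 2 (S r)) has_real_derivative
      (flat_exp 4 (S r) - 2 * flat_exp 3 (S r)) * (2 * (norm (z - x))\<^sup>2 / r ^ 3)) (at r)"
    by simp
  have "((\<lambda>r. 2 * inverse (r ^ DIM('a))) has_real_derivative
      2 * (- (DIM('a) * r ^ (DIM('a) - 1)) * inverse ((r ^ DIM('a))\<^sup>2))) (at r)"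
    using r by (auto intro!: derivative_eq_intros simp: power2_eq_square)
  moreover have "r ^ DIM('a) = r * r ^ (DIM('a) - 1)"
    by (simp flip: power_Suc)
  then have "2 * (- (DIM('a) * r ^ (DIM('a) - 1)) * inverse ((r ^ DIM('a))\<^sup>2)) = - 2 * DIM('a) / (r * r ^ DIM('a))"
    using r by (simp add: field_simps power2_eq_square)
  ultimately have "((\<lambda>r. 2 * inverse (r ^ DIM('a))) has_real_derivative - 2 * DIM('a) / (r * r ^ DIM('a))) (at r)"
    by (simp only:)
  then have 2: "((\<lambda>r. 2 / r ^ DIM('a)) has_real_derivative - 2 * DIM('a) / (r * r ^ DIM('a))) (at r)"
    by (simp only: divide_inverse)
  show ?thesis
    unfolding kern_def laplacian_pot[OF r] S_def[symmetric]
    by (rule DERIV_cong[OF DERIV_mult[OF 2 1[unfolded S_def]]])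
       (use r in \<open>simp add: S_def field_simps power2_eq_square power3_eq_cube power4_eq_xxxx\<close>)
qed

lemma integral_lborel_cbox:
  fixes F :: "'a::euclidean_space \<Rightarrow> real"
  assumes "continuous_on UNIV F" "\<And>z. z \<notin> cbox a b \<Longrightarrow> F z = 0"
  shows "integral\<^sup>L lborel F = integral (cbox a b) F"
proof -
  have "integrable lborel F"
    using assms by (intro integrable_compact_support[of "cbox a b"]) (auto intro: continuous_on_subset)
  then have "integral\<^sup>L lborel F = integral UNIV F"
    by (simp add: integral_lborel)
  also have "integral UNIV F = integral UNIV (\<lambda>z. if z \<in> cbox a b then F z else 0)"
    using assms(2) by (intro integral_cong) auto
  finally show ?thesis by (simp add: integral_restrict_UNIV)
qed

lemma mean_has_derivative_continuous:
  fixes v :: "'a::euclidean_space \<Rightarrow> real"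
  assumes v: "continuous_on UNIV v" and r: "0 < r"
  shows "((\<lambda>r. \<integral>z. v z * kern x r z \<partial>lborel) has_real_derivative
      (\<integral>z. v z * laplacian (pot x r) z \<partial>lborel)) (at r)"
proof -
  obtain c :: 'a where c: "cball x (2 * r) \<subseteq> cbox (- c) c"
    using bounded_subset_cbox_symmetric[OF bounded_cball] .
  let ?U = "{r / 2 <..< 2 * r}"
  have out: "z \<notin> cball x s" if "z \<notin> cbox (- c) c" "s \<in> ?U" for z s
    using c that subset_cball[of s "2 * r" x] by auto
  have cont: "continuous_on UNIV (\<lambda>z. v z * kern x s z)" for s
    by (intro continuous_intros v elem_smooth_continuous kern_elem_smooth)
  have "((\<lambda>r. integral (cbox (- c) c) (\<lambda>z. v z * kern x r z)) has_real_derivative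
     integral (cbox (- c) c) (\<lambda>z. v z * laplacian (pot x r) z)) (at r within ?U)"
  proof (rule leibniz_rule_field_derivative)
    show "((\<lambda>r. v z * kern x r z) has_real_derivative v z * laplacian (pot x s) z) (at s within ?U)"
      if "s \<in> ?U" for s z
      using that r kern_has_derivative_radius[of s x z]
      by (intro DERIV_cmult) (auto intro: has_field_derivative_at_within)
    show "(\<lambda>z. v z * kern x s z) integrable_on cbox (- c) c" if "s \<in> ?U" for s
      using cont by (intro integrable_continuous) (blast intro: continuous_on_subset)
    have "continuous_on (?U \<times> cbox (- c) c) (\<lambda>p. v (snd p) * (fst p / fst p ^ DIM('a) *
      ((flat_exp 4 (1 - (norm (snd p - x))\<^sup>2 / (fst p)\<^sup>2) - 2 * flat_exp 3 (1 - (norm (snd p - x))\<^sup>2 / (fst p)\<^sup>2))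
     * (4 * (norm (snd p - x))\<^sup>2 / fst p ^ 4) - 2 * DIM('a) * flat_exp 2 (1 - (norm (snd p - x))\<^sup>2 / (fst p)\<^sup>2) / (fst p)\<^sup>2)))"
      using r by (intro continuous_intros continuous_on_compose2[OF flat_exp_continuous[of UNIV]]
          continuous_on_compose2[OF v]) auto
    then show "continuous_on (?U \<times> cbox (- c) c) (\<lambda>(s, z). v z * laplacian (pot x s) z)"
      by (rule continuous_on_eq) (use r in \<open>auto simp: laplacian_pot\<close>)
  qed (use r in auto)
  moreover have "integral (cbox (- c) c) (\<lambda>z. v z * kern x s z) = (\<integral>z. v z * kern x s z \<partial>lborel)"
    if "s \<in> ?U" for s
  proof (intro integral_lborel_cbox[symmetric] cont)
    fix z assume "z \<notin> cbox (- c) c"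
    then have "z \<notin> ball x s" using out[OF _ that] ball_subset_cball by blast
    then show "v z * kern x s z = 0" using kern_support[of s z x] that r by auto
  qed
  moreover have "integral (cbox (- c) c) (\<lambda>z. v z * laplacian (pot x r) z) =
      (\<integral>z. v z * laplacian (pot x r) z \<partial>lborel)"
  proof (intro integral_lborel_cbox[symmetric])
    show "continuous_on UNIV (\<lambda>z. v z * laplacian (pot x r) z)"
      by (intro continuous_intros v elem_smooth_continuous elem_smooth_laplacian pot_elem_smooth)
    show "v z * laplacian (pot x r) z = 0" if "z \<notin> cbox (- c) c" for z
      using out[OF that, of r] r
      by (subst laplacian_support[of x r]) (auto intro: pot_support)
  qed
  ultimately have "((\<lambda>r. integral (cbox (- c) c) (\<lambda>z. v z * kern x r z)) has_real_derivative
     (\<integral>z. v z * laplacian (pot x r) z \<partial>lborel)) (at r)"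
    using r at_within_open[of r ?U] by simp
  then show ?thesis
    by (rule has_field_derivative_transform_within_open[of _ _ _ ?U])
       (use r \<open>\<And>s. s \<in> ?U \<Longrightarrow> _\<close> in auto)
qed

section \<open>Mean values of weak solutions\<close>

text \<open>
  The equation \<open>\<Delta>v = f\<close> in the sense of distributions, for continuous \<open>v\<close> and \<open>f\<close>, tested only against the
  functions \<open>pot x r\<close>. These suffice for the mean value properties, and in contrast to the equation
  \<open>\<Delta>u = g(x, u)\<close> the notion is stable under subtraction of smooth functions.
\<close>

definition weak_poisson :: "'a::euclidean_space set \<Rightarrow> ('a \<Rightarrow> real) \<Rightarrow> ('a \<Rightarrow> real) \<Rightarrow> bool" where
  "weak_poisson \<Omega> v f \<longleftrightarrow> open \<Omega> \<and> continuous_on \<Omega> v \<and> continuous_on \<Omega> f \<and>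
     (\<forall>x r. 0 < r \<and> cball x r \<subseteq> \<Omega> \<longrightarrow>
        (\<integral>z. v z * laplacian (pot x r) z \<partial>lborel) = (\<integral>z. f z * pot x r z \<partial>lborel))"

lemma integrable_local:
  fixes v k :: "'a::euclidean_space \<Rightarrow> real"
  assumes "continuous_on (cball x r) v" "continuous_on (cball x r) k"
    and "\<And>z. z \<notin> cball x r \<Longrightarrow> k z = 0"
  shows "integrable lborel (\<lambda>z. v z * k z)"
  using assms by (intro integrable_compact_support[of "cball x r"] continuous_intros) auto

lemma integrable_kern:
  assumes "continuous_on (cball x r) v" "0 < r"
  shows "integrable lborel (\<lambda>z. v z * kern x r z)"
  by (rule integrable_local[OF assms(1)])
     (use assms in \<open>auto intro!: elem_smooth_continuous kern_elem_smooth kern_support\<close>)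

lemma integrable_pot:
  assumes "continuous_on (cball x r) v" "0 < r"
  shows "integrable lborel (\<lambda>z. v z * pot x r z)"
  by (rule integrable_local[OF assms(1)])
     (use assms in \<open>auto intro!: elem_smooth_continuous pot_elem_smooth pot_support\<close>)

lemma weak_poisson_diff:
  assumes v: "weak_poisson \<Omega> v f" and w: "elem_smooth w"
  shows "weak_poisson \<Omega> (\<lambda>z. v z - w z) (\<lambda>z. f z - laplacian w z)"
  unfolding weak_poisson_def
proof (intro conjI allI impI)
  show "open \<Omega>" using v by (simp add: weak_poisson_def)
  show "continuous_on \<Omega> (\<lambda>z. v z - w z)" "continuous_on \<Omega> (\<lambda>z. f z - laplacian w z)"
    using v w by (auto simp: weak_poisson_def
        intro!: continuous_on_diff intro: elem_smooth_continuous elem_smooth_laplacian)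
  fix x r assume xr: "0 < r \<and> cball x r \<subseteq> \<Omega>"
  then have cv: "continuous_on (cball x r) v" "continuous_on (cball x r) f"
    using v by (auto simp: weak_poisson_def intro: continuous_on_subset)
  have supp: "pot x r z = 0" if "z \<notin> cball x r" for z
    using that xr by (intro pot_support) auto
  note supp' = laplacian_support[of x r "pot x r", OF supp]
  have "(\<integral>z. (v z - w z) * laplacian (pot x r) z \<partial>lborel) =
     (\<integral>z. v z * laplacian (pot x r) z \<partial>lborel) - (\<integral>z. w z * laplacian (pot x r) z \<partial>lborel)"
    unfolding left_diff_distrib using supp' w xr
    by (intro Bochner_Integration.integral_diff integrable_local[of x r] cv elem_smooth_continuous
        elem_smooth_laplacian pot_elem_smooth) auto
  also have "\<dots> = (\<integral>z. f z * pot x r z \<partial>lborel) - (\<integral>z. laplacian w z * pot x r z \<partial>lborel)"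
    using v xr green_identity[OF w pot_elem_smooth supp] by (simp add: weak_poisson_def)
  also have "\<dots> = (\<integral>z. (f z - laplacian w z) * pot x r z \<partial>lborel)"
    unfolding left_diff_distrib using w xr
    by (intro Bochner_Integration.integral_diff[symmetric] integrable_pot cv elem_smooth_continuous
        elem_smooth_laplacian) auto
  finally show "(\<integral>z. (v z - w z) * laplacian (pot x r) z \<partial>lborel) =
      (\<integral>z. (f z - laplacian w z) * pot x r z \<partial>lborel)" .
qed

text \<open>
  As \<open>v\<close> is continuous only on \<open>\<Omega>\<close>, it is first replaced by a continuous function on the whole space that
  agrees with it on a closed ball containing the supports of the kernels.
\<close>

lemma mean_has_derivative:
  assumes v: "weak_poisson \<Omega> v f" and r: "0 < r" "r < R" and sub: "cball x R \<subseteq> \<Omega>"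
  shows "((\<lambda>r. \<integral>z. v z * kern x r z \<partial>lborel) has_real_derivative
      (\<integral>z. f z * pot x r z \<partial>lborel)) (at r)"
proof -
  have "continuous_on (cball x R) v"
    using v sub by (auto simp: weak_poisson_def intro: continuous_on_subset)
  then obtain v' where v': "continuous_on UNIV v'" "\<And>z. z \<in> cball x R \<Longrightarrow> v' z = v z"
    using Tietze_unbounded[of "cball x R" v UNIV] by auto
  have eq: "v' z * k z = v z * k z" if "\<And>z. z \<notin> cball x R \<Longrightarrow> k z = 0" for z k
    using v'(2) that by (cases "z \<in> cball x R") (auto simp del: mem_cball)
  have "((\<lambda>r. \<integral>z. v' z * kern x r z \<partial>lborel) has_real_derivative
      (\<integral>z. v' z * laplacian (pot x r) z \<partial>lborel)) (at r)"
    by (rule mean_has_derivative_continuous[OF v'(1) r(1)])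
  then have "((\<lambda>r. \<integral>z. v z * kern x r z \<partial>lborel) has_real_derivative
      (\<integral>z. v' z * laplacian (pot x r) z \<partial>lborel)) (at r)"
  proof (rule has_field_derivative_transform_within_open[of _ _ _ "{0<..<R}"])
    fix s assume "s \<in> {0<..<R}"
    then have "kern x s z = 0" if "z \<notin> cball x R" for z
      using that by (intro kern_support) auto
    then show "(\<integral>z. v' z * kern x s z \<partial>lborel) = (\<integral>z. v z * kern x s z \<partial>lborel)"
      by (intro Bochner_Integration.integral_cong refl eq)
  qed (use r in auto)
  also have "(\<integral>z. v' z * laplacian (pot x r) z \<partial>lborel) = (\<integral>z. v z * laplacian (pot x r) z \<partial>lborel)"
    using r by (intro Bochner_Integration.integral_cong refl eq laplacian_support[of x R] pot_support) auto
  also have "\<dots> = (\<integral>z. f z * pot x r z \<partial>lborel)"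
  proof -
    have "cball x r \<subseteq> \<Omega>" using r sub subset_cball[of r R x] by auto
    then show ?thesis using v r by (simp add: weak_poisson_def)
  qed
  finally show ?thesis .
qed

lemma weak_poisson_const: "weak_poisson UNIV (\<lambda>x. c) (\<lambda>x. 0)"
  unfolding weak_poisson_def
proof (intro conjI allI impI)
  fix x :: 'a and r :: real assume r: "0 < r \<and> cball x r \<subseteq> UNIV"
  have lap: "laplacian (\<lambda>x::'a. c) z = 0" for z
    unfolding laplacian_def
    by (intro sum.neutral ballI) (simp add: partial_deriv_def[abs_def])
  show "(\<integral>z. c * laplacian (pot x r) z \<partial>lborel) = (\<integral>z. 0 * pot x r z \<partial>lborel)"
    using green_identity[OF elem_smooth.const[of c] pot_elem_smooth[of x r], of x r] r
    by (simp add: lap pot_support)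
qed auto

text \<open>
  The constant function \<open>1\<close> is harmonic, so its weighted means do not depend on the radius; this
  avoids rescaling the integral.
\<close>

lemma kern_mass:
  fixes x :: "'a::euclidean_space"
  assumes "0 < r"
  shows "(\<integral>z. kern x r z \<partial>lborel) = (\<integral>z. kern (0::'a) 1 z \<partial>lborel)"
proof -
  have "((\<lambda>r. \<integral>z. 1 * kern x r z \<partial>lborel) has_real_derivative 0) (at s within {0<..})"
    if "s \<in> {0<..}" for s
    using mean_has_derivative[OF weak_poisson_const[of 1], of s "s + 1" x] that
    by (auto intro: has_field_derivative_at_within)
  then have "\<exists>c. \<forall>s\<in>{0<..}. (\<integral>z. 1 * kern x s z \<partial>lborel) = c"
    by (intro has_field_derivative_zero_constant) auto
  then have "(\<integral>z. kern x r z \<partial>lborel) = (\<integral>z. kern x 1 z \<partial>lborel)"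
    using assms by auto
  also have "\<dots> = (\<integral>z. kern x 1 z \<partial>distr lborel borel ((+) x))"
    by (simp add: lborel_distr_plus)
  also have "\<dots> = (\<integral>z. kern x 1 (x + z) \<partial>lborel)"
    by (intro integral_distr)
       (auto intro!: borel_measurable_continuous_onI elem_smooth_continuous kern_elem_smooth)
  also have "\<dots> = (\<integral>z. kern (0::'a) 1 z \<partial>lborel)"
    by (simp add: kern_def)
  finally show ?thesis .
qed

lemma integral_pos:
  fixes F :: "'a::euclidean_space \<Rightarrow> real"
  assumes F: "continuous_on (cball x r) F" "\<And>z. z \<in> cball x r \<Longrightarrow> 0 \<le> F z" "\<And>z. z \<notin> cball x r \<Longrightarrow> F z = 0"
    and y: "y \<in> ball x r" "0 < F y"
  shows "0 < integral\<^sup>L lborel F"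
proof -
  have int: "integrable lborel F"
    using F by (intro integrable_compact_support[of "cball x r"]) auto
  have nn: "0 \<le> F z" for z using F(2,3)[of z] by fastforce
  obtain a b where ab: "y \<in> box a b" "cbox a b \<subseteq> ball x r"
    using open_contains_cbox[of "ball x r" y] y by (metis open_ball)
  have "integral (cbox a b) F \<le> integral UNIV F"
    using int nn ab
    by (intro integral_subset_le integrable_continuous continuous_on_subset[OF F(1)] integrable_on_lborel)
       (auto simp: subset_eq less_imp_le)
  moreover have "0 < integral (cbox a b) F"
  proof (rule ccontr)
    have i: "F integrable_on cbox a b"
      using ab by (intro integrable_continuous continuous_on_subset[OF F(1)]) (auto simp: subset_eq less_imp_le)
    assume "\<not> 0 < integral (cbox a b) F"
    moreover have "0 \<le> integral (cbox a b) F" by (intro integral_nonneg i nn)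
    ultimately have "(F has_integral 0) (cbox a b)"
      using i by (metis antisym_conv2 integrable_integral not_less)
    then have "F y = 0"
      using ab box_subset_cbox[of a b]
      by (intro has_integral_0_cbox_imp_0[of a b F] continuous_on_subset[OF F(1)])
         (auto simp: subset_eq nn less_imp_le)
    with y show False by simp
  qed
  ultimately show ?thesis using integral_lborel[OF int] by simp
qed

lemma kern_mass_pos: "0 < (\<integral>z. kern (0::'a::euclidean_space) 1 z \<partial>lborel)"
  by (rule integral_pos[where x=0 and r=1 and y=0])
     (auto intro!: elem_smooth_continuous kern_elem_smooth kern_nonneg kern_pos kern_support)

lemma kern_integral_le:
  fixes x :: "'a::euclidean_space"
  assumes "0 < r" "continuous_on (cball x r) v" "continuous_on (cball x r) w"
    "\<And>z. z \<in> ball x r \<Longrightarrow> v z \<le> w z"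
  shows "(\<integral>z. v z * kern x r z \<partial>lborel) \<le> (\<integral>z. w z * kern x r z \<partial>lborel)"
proof (rule integral_mono)
  fix z show "v z * kern x r z \<le> w z * kern x r z"
    using assms kern_nonneg[of r x z] kern_support[of r z x]
    by (cases "z \<in> ball x r") (auto intro: mult_right_mono simp del: mem_ball)
qed (intro integrable_kern assms)+

lemma mean_tendsto:
  fixes x :: "'a::euclidean_space"
  assumes R: "0 < R" and v: "continuous_on (cball x R) v"
  shows "((\<lambda>r. \<integral>z. v z * kern x r z \<partial>lborel) \<longlongrightarrow> v x * (\<integral>z. kern (0::'a) 1 z \<partial>lborel)) (at_right 0)"
proof (rule tendstoI)
  fix e :: real assume e: "0 < e"
  let ?\<kappa> = "\<integral>z. kern (0::'a) 1 z \<partial>lborel"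
  define e' where "e' = e / (2 * ?\<kappa>)"
  have e': "0 < e'" using e kern_mass_pos[where 'a='a] by (simp add: e'_def)
  obtain d where d: "0 < d" "\<And>z. z \<in> cball x R \<Longrightarrow> dist z x < d \<Longrightarrow> dist (v z) (v x) < e'"
    using v e' R unfolding continuous_on_iff by (metis centre_in_cball less_imp_le)
  have "dist (\<integral>z. v z * kern x r z \<partial>lborel) (v x * ?\<kappa>) < e" if r: "0 < r" "r < min d R" for r
  proof -
    have cv: "continuous_on (cball x r) v"
      using v by (rule continuous_on_subset) (use r in auto)
    have near: "\<bar>v z - v x\<bar> \<le> e'" if "z \<in> ball x r" for z
      using d(2)[of z] that r by (auto simp: dist_commute dist_real_def)
    have int1: "(\<integral>z. c * kern x r z \<partial>lborel) = c * ?\<kappa>" for c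
      using kern_mass[OF r(1), of x] by simp
    have "(\<integral>z. (v x - e') * kern x r z \<partial>lborel) \<le> (\<integral>z. v z * kern x r z \<partial>lborel)"
      using near by (intro kern_integral_le r cv continuous_intros) (force simp: abs_le_iff)
    moreover have "(\<integral>z. v z * kern x r z \<partial>lborel) \<le> (\<integral>z. (v x + e') * kern x r z \<partial>lborel)"
      using near by (intro kern_integral_le r cv continuous_intros) (force simp: abs_le_iff)
    ultimately have "\<bar>(\<integral>z. v z * kern x r z \<partial>lborel) - v x * ?\<kappa>\<bar> \<le> e' * ?\<kappa>"
      unfolding int1 by (simp add: algebra_simps abs_le_iff)
    also have "e' * ?\<kappa> < e" using e kern_mass_pos[where 'a='a] by (simp add: e'_def)
    finally show ?thesis by (simp add: dist_real_def)
  qed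
  then show "\<forall>\<^sub>F r in at_right 0. dist (\<integral>z. v z * kern x r z \<partial>lborel) (v x * ?\<kappa>) < e"
    unfolding eventually_at_right_field using d R by (intro exI[of _ "min d R"]) auto
qed

text \<open>
  For \<open>f \<ge> 0\<close> the means increase with the radius, and they tend to \<open>v x\<close> times the mass as it shrinks.
\<close>

lemma sub_mean_value:
  fixes x :: "'a::euclidean_space"
  assumes v: "weak_poisson \<Omega> v f" and r: "0 < r" "r < R" and sub: "cball x R \<subseteq> \<Omega>"
    and f: "\<And>z. z \<in> ball x R \<Longrightarrow> 0 \<le> f z"
  shows "v x * (\<integral>z. kern (0::'a) 1 z \<partial>lborel) \<le> (\<integral>z. v z * kern x r z \<partial>lborel)"
proof (rule tendsto_upperbound[OF mean_tendsto])
  show "0 < R" using r by simp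
  show "continuous_on (cball x R) v"
    using v sub by (auto simp: weak_poisson_def intro: continuous_on_subset)
  have "(\<integral>z. v z * kern x s z \<partial>lborel) \<le> (\<integral>z. v z * kern x r z \<partial>lborel)" if s: "0 < s" "s < r" for s
  proof (rule DERIV_nonneg_imp_nondecreasing[where f = "\<lambda>s. \<integral>z. v z * kern x s z \<partial>lborel"])
    fix t assume t: "s \<le> t" "t \<le> r"
    have "0 \<le> f z * pot x t z" for z
    proof (cases "z \<in> ball x t")
      case True
      then show ?thesis using f[of z] t s r pot_nonneg[of t x z] by auto
    next
      case False
      then show ?thesis using pot_support[of t z x] t s by simp
    qed
    then have "0 \<le> (\<integral>z. f z * pot x t z \<partial>lborel)" by (intro Bochner_Integration.integral_nonneg)
    then show "\<exists>y. ((\<lambda>s. \<integral>z. v z * kern x s z \<partial>lborel) has_real_derivative y) (at t) \<and> 0 \<le> y"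
      using mean_has_derivative[OF v _ _ sub, of t] t s r by auto
  qed (use s in simp)
  then show "\<forall>\<^sub>F s in at_right 0. (\<integral>z. v z * kern x s z \<partial>lborel) \<le> (\<integral>z. v z * kern x r z \<partial>lborel)"
    unfolding eventually_at_right_field using r by (intro exI[of _ r]) auto
qed auto

text \<open>
  The derivative of the mean \<open>m r\<close> is the integral of \<open>f * pot x r\<close>, hence at most \<open>\<Lambda> * r / 2 * m r\<close>, since
  \<open>pot\<close> is at most \<open>r / 2\<close> times \<open>kern\<close>. Thus \<open>exp (- \<Lambda> r\<^sup>2 / 4) * m r\<close> decreases.
\<close>

lemma super_mean_value:
  fixes x :: "'a::euclidean_space"
  assumes v: "weak_poisson \<Omega> v f" and r: "0 < r" "r < R" and sub: "cball x R \<subseteq> \<Omega>"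
    and f: "\<And>z. z \<in> ball x R \<Longrightarrow> f z \<le> \<Lambda> * v z" and nn: "\<And>z. z \<in> ball x R \<Longrightarrow> 0 \<le> v z" and \<Lambda>: "0 \<le> \<Lambda>"
  shows "(\<integral>z. v z * kern x r z \<partial>lborel) \<le> exp (\<Lambda> * r\<^sup>2 / 4) * v x * (\<integral>z. kern (0::'a) 1 z \<partial>lborel)"
proof -
  define m where "m s = (\<integral>z. v z * kern x s z \<partial>lborel)" for s
  have cv: "continuous_on (cball x s) v" "continuous_on (cball x s) f" if "s \<le> R" for s
    using v sub subset_cball[OF that, of x] by (auto simp: weak_poisson_def intro: continuous_on_subset)
  have mono: "exp (- (\<Lambda> * r\<^sup>2 / 4)) * m r \<le> exp (- (\<Lambda> * s\<^sup>2 / 4)) * m s" if s: "0 < s" "s < r" for s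
  proof (rule DERIV_nonpos_imp_nonincreasing[where f = "\<lambda>s. exp (- (\<Lambda> * s\<^sup>2 / 4)) * m s"])
    fix t assume t: "s \<le> t" "t \<le> r"
    have "(\<integral>z. f z * pot x t z \<partial>lborel) \<le> (\<integral>z. \<Lambda> * t / 2 * (v z * kern x t z) \<partial>lborel)"
    proof (rule integral_mono)
      show "integrable lborel (\<lambda>z. f z * pot x t z)"
        using t s r by (intro integrable_pot cv) auto
      show "integrable lborel (\<lambda>z. \<Lambda> * t / 2 * (v z * kern x t z))"
        using t s r by (intro integrable_mult_right integrable_kern cv) auto
      fix z show "f z * pot x t z \<le> \<Lambda> * t / 2 * (v z * kern x t z)"
      proof (cases "z \<in> ball x t")
        case True
        then have z: "z \<in> ball x R" using t r by auto
        have "f z * pot x t z \<le> (\<Lambda> * v z) * pot x t z"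
          using f[OF z] pot_nonneg[of t x z] t s by (intro mult_right_mono) auto
        also have "\<dots> \<le> (\<Lambda> * v z) * (t / 2 * kern x t z)"
          using nn[OF z] \<Lambda> t s by (intro mult_left_mono pot_le_kern) auto
        finally show ?thesis by (simp add: mult_ac)
      next
        case False
        then show ?thesis using pot_support[of t z x] kern_support[of t z x] t s by simp
      qed
    qed
    then have le: "(\<integral>z. f z * pot x t z \<partial>lborel) \<le> \<Lambda> * t / 2 * m t"
      by (simp add: m_def)
    have "((\<lambda>s. exp (- (\<Lambda> * s\<^sup>2 / 4)) * m s) has_real_derivative
      exp (- (\<Lambda> * t\<^sup>2 / 4)) * ((\<integral>z. f z * pot x t z \<partial>lborel) - \<Lambda> * t / 2 * m t)) (at t)"
      using mean_has_derivative[OF v _ _ sub, of t, folded m_def] t s r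
      by (auto intro!: derivative_eq_intros simp: algebra_simps)
    moreover have "exp (- (\<Lambda> * t\<^sup>2 / 4)) * ((\<integral>z. f z * pot x t z \<partial>lborel) - \<Lambda> * t / 2 * m t) \<le> 0"
      using le by (simp add: mult_le_0_iff)
    ultimately show "\<exists>y. ((\<lambda>s. exp (- (\<Lambda> * s\<^sup>2 / 4)) * m s) has_real_derivative y) (at t) \<and> y \<le> 0"
      by blast
  qed (use s in simp)
  have "((\<lambda>s. exp (- (\<Lambda> * s\<^sup>2 / 4)) * m s) \<longlongrightarrow>
      exp (- (\<Lambda> * 0\<^sup>2 / 4)) * (v x * (\<integral>z. kern (0::'a) 1 z \<partial>lborel))) (at_right 0)"
    unfolding m_def using r by (intro tendsto_intros mean_tendsto[of R] cv) auto
  then have "exp (- (\<Lambda> * r\<^sup>2 / 4)) * m r \<le> exp (- (\<Lambda> * 0\<^sup>2 / 4)) * (v x * (\<integral>z. kern (0::'a) 1 z \<partial>lborel))"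
    by (rule tendsto_lowerbound)
       (use mono r in \<open>auto simp: eventually_at_right_field intro!: exI[of _ r]\<close>)
  then show ?thesis
    by (simp add: m_def exp_minus field_simps)
qed

section \<open>Maximum principle and Harnack inequality\<close>

lemma strong_max_local:
  fixes x :: "'a::euclidean_space"
  assumes v: "weak_poisson \<Omega> v f" and R: "0 < R" "cball x R \<subseteq> \<Omega>"
    and f: "\<And>z. z \<in> ball x R \<Longrightarrow> 0 \<le> f z"
    and max: "\<And>z. z \<in> ball x R \<Longrightarrow> v z \<le> v x"
    and z: "z \<in> ball x (R / 2)"
  shows "v z = v x"
proof (rule ccontr)
  assume "v z \<noteq> v x"
  have cv: "continuous_on (cball x (R / 2)) v"
    using v R by (auto simp: weak_poisson_def subset_eq intro!: continuous_on_subset[of \<Omega> v])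
  have z': "z \<in> ball x R" using z R by auto
  have "0 < (\<integral>z. (v x - v z) * kern x (R / 2) z \<partial>lborel)"
  proof (rule integral_pos[of x "R / 2"])
    show "0 < (v x - v z) * kern x (R / 2) z"
      using max[OF z'] \<open>v z \<noteq> v x\<close> z R by (intro mult_pos_pos kern_pos) auto
  qed (use R z max in \<open>auto intro!: continuous_on_mult continuous_on_diff cv mult_nonneg_nonneg kern_nonneg kern_support
        elem_smooth_continuous[OF kern_elem_smooth] continuous_on_const\<close>)
  also have "\<dots> = (\<integral>z. v x * kern x (R / 2) z \<partial>lborel) - (\<integral>z. v z * kern x (R / 2) z \<partial>lborel)"
    unfolding left_diff_distrib using R cv
    by (intro Bochner_Integration.integral_diff integrable_kern continuous_on_const) auto
  also have "\<dots> \<le> 0"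
    using sub_mean_value[OF v _ _ R(2) f, of "R / 2"] R kern_mass[of "R / 2" x] by simp
  finally show False by simp
qed

text \<open>
  The points where a positive maximum is attained would form a nonempty bounded set that is open, by
  the mean value property, and closed. The function \<open>U\<close> carries the boundary values: \<open>v\<close> itself need
  not be defined meaningfully on the frontier of \<open>D\<close>.
\<close>

lemma max_principle:
  fixes D :: "'a::euclidean_space set"
  assumes v: "weak_poisson \<Omega> v f" and D: "open D" "bounded D" "D \<subseteq> \<Omega>"
    and f: "\<And>z. z \<in> D \<Longrightarrow> 0 \<le> f z"
    and U: "continuous_on (closure D) U" "\<And>z. z \<in> D \<Longrightarrow> U z = v z" "\<And>z. z \<in> frontier D \<Longrightarrow> U z \<le> 0"
    and x: "x \<in> D"
  shows "U x \<le> 0"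
proof (rule ccontr)
  assume pos: "\<not> U x \<le> 0"
  have "compact (closure D)" using D by (simp add: compact_closure)
  then obtain m where m: "m \<in> closure D" "\<And>z. z \<in> closure D \<Longrightarrow> U z \<le> U m"
    using continuous_attains_sup[OF _ _ U(1)] x closure_subset by blast
  have "0 < U m" using m(2)[of x] x closure_subset[of D] pos by fastforce
  define S where "S = {z \<in> closure D. U z = U m}"
  have SD: "S \<subseteq> D"
    using U(3) \<open>0 < U m\<close> D(1) by (fastforce simp: S_def frontier_def interior_open)
  have "closed S"
    unfolding S_def by (intro continuous_closed_preimage_constant U) auto
  moreover have "open S"
    unfolding open_contains_ball
  proof
    fix z assume z: "z \<in> S"
    then obtain R where R: "0 < R" "cball z R \<subseteq> D"
      using SD D(1) open_contains_cball by blast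
    have "U y = U m" if "y \<in> ball z (R / 2)" for y
    proof -
      have y: "y \<in> D" using that R ball_subset_cball[of z R] by auto
      have "v y = v z"
      proof (rule strong_max_local[OF v R(1)])
        show "cball z R \<subseteq> \<Omega>" using R D by auto
        show "v a \<le> v z" if "a \<in> ball z R" for a
          using m(2)[of a] z that R SD closure_subset[of D] U(2)[of a] U(2)[of z] by (auto simp: S_def subset_eq)
        show "0 \<le> f a" if "a \<in> ball z R" for a
          using that R by (intro f) (auto simp: subset_eq)
      qed (use that in auto)
      then show ?thesis using y z SD U(2) by (auto simp: S_def)
    qed
    then show "\<exists>e>0. ball z e \<subseteq> S"
      using R closure_subset[of D] by (intro exI[of _ "R / 2"]) (auto simp: S_def subset_eq)
  qed
  moreover have "m \<in> S" using m by (simp add: S_def)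
  ultimately have "S = UNIV" using clopen by blast
  then have "bounded (UNIV :: 'a set)" using SD D(2) by (metis bounded_subset)
  then show False by simp
qed

text \<open>
  The value at \<open>x\<close> is at most a mean over a small ball around \<open>x\<close>; that mean is at most a multiple of
  a mean over a larger ball around \<open>y\<close>, which is at most a multiple of the value at \<open>y\<close>.
\<close>

lemma harnack:
  fixes x y :: "'a::euclidean_space"
  assumes v: "weak_poisson \<Omega> v f" and R: "0 < R" "cball y R \<subseteq> \<Omega>" and A: "0 \<le> A"
    and f: "\<And>z. z \<in> ball y R \<Longrightarrow> 0 \<le> f z" "\<And>z. z \<in> ball y R \<Longrightarrow> f z \<le> A / R\<^sup>2 * v z"
    and nn: "\<And>z. z \<in> ball y R \<Longrightarrow> 0 \<le> v z" and xy: "dist x y \<le> R / 4"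
  shows "v x \<le> 2 * 4 ^ DIM('a) * exp (3 + A) * v y"
proof -
  let ?\<kappa> = "\<integral>z. kern (0::'a) 1 z \<partial>lborel"
  have sub: "ball x s \<subseteq> ball y t" "cball x s \<subseteq> cball y t" if "R / 4 + s \<le> t" for s t
  proof -
    have "dist y z \<le> R / 4 + dist x z" for z
      using dist_triangle[of y z x] xy by (simp add: dist_commute)
    then show "ball x s \<subseteq> ball y t" "cball x s \<subseteq> cball y t"
      using that by (auto simp: subset_eq) (smt (verit))+
  qed
  have cv: "continuous_on (cball x (R / 8)) v" "continuous_on (cball y (R / 2)) v"
    using v R sub(2)[of "R / 8" R]
    by (auto simp: weak_poisson_def subset_eq intro!: continuous_on_subset[of \<Omega> v])
  \<comment> \<open>The ball of radius \<open>R / 8\<close> around \<open>x\<close> lies in the one of radius \<open>3 R / 8\<close> around \<open>y\<close>, where \<open>kern y (R / 2)\<close> is bounded below.\<close>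
  have comp: "kern x (R / 8) z \<le> 2 * 4 ^ DIM('a) * exp 3 * kern y (R / 2) z" for z
  proof (cases "z \<in> ball x (R / 8)")
    case True
    then have "z \<in> ball y (3 * R / 8)" using sub(1)[of "R / 8" "3 * R / 8"] by auto
    then have "norm (z - y) \<le> 3 * R / 8" by (simp add: dist_norm norm_minus_commute)
    then have "(norm (z - y))\<^sup>2 \<le> (3 * R / 8)\<^sup>2" by (intro power_mono) auto
    then have t: "7 / 16 \<le> 1 - (norm (z - y))\<^sup>2 / (R / 2)\<^sup>2"
      using R by (simp add: field_simps power2_eq_square)
    define t where "t = 1 - (norm (z - y))\<^sup>2 / (R / 2)\<^sup>2"
    have t: "7 / 16 \<le> t" "t \<le> 1" using t by (auto simp: t_def)
    have "exp (- 3) * 1 \<le> exp (- inverse t) * inverse t ^ 2"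
      using t by (intro mult_mono one_le_power one_le_inverse) (auto simp: field_simps)
    then have "exp (- 3) \<le> flat_exp 2 t" using t by (simp add: flat_exp_def mult.commute)
    then have 1: "2 / (R / 2) ^ DIM('a) * exp (- 3) \<le> kern y (R / 2) z"
      unfolding kern_def t_def using R by (intro mult_left_mono) auto
    have "kern x (R / 8) z \<le> 2 / (R / 8) ^ DIM('a) * 2"
      unfolding kern_def using R by (intro mult_left_mono flat_exp_2_le) auto
    also have "\<dots> = 2 * 4 ^ DIM('a) * exp 3 * (2 / (R / 2) ^ DIM('a) * exp (- 3))"
    proof -
      have "(R / 2) ^ DIM('a) = 4 ^ DIM('a) * (R / 8) ^ DIM('a)"
        by (simp flip: power_mult_distrib)
      then show ?thesis using R by (simp add: exp_minus)
    qed
    also have "\<dots> \<le> 2 * 4 ^ DIM('a) * exp 3 * kern y (R / 2) z"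
      by (intro mult_left_mono 1) auto
    finally show ?thesis .
  next
    case False
    then show ?thesis using kern_support[of "R / 8" z x] kern_nonneg[of "R / 2" y z] R by simp
  qed
  have "v x * ?\<kappa> \<le> (\<integral>z. v z * kern x (R / 8) z \<partial>lborel)"
  proof (rule sub_mean_value[OF v, of _ "R / 4"])
    show "cball x (R / 4) \<subseteq> \<Omega>" using sub(2)[of "R / 4" R] R by auto
    show "0 \<le> f z" if "z \<in> ball x (R / 4)" for z using f(1)[of z] sub(1)[of "R / 4" R] R that by auto
  qed (use R in auto)
  also have "\<dots> \<le> (\<integral>z. 2 * 4 ^ DIM('a) * exp 3 * (v z * kern y (R / 2) z) \<partial>lborel)"
  proof (rule integral_mono)
    fix z
    show "v z * kern x (R / 8) z \<le> 2 * 4 ^ DIM('a) * exp 3 * (v z * kern y (R / 2) z)"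
    proof (cases "z \<in> ball y R")
      case True
      from mult_left_mono[OF comp[of z] nn[OF True]] show ?thesis by (simp add: mult_ac)
    next
      case False
      moreover have "z \<notin> ball x (R / 8)" using False sub(1)[of "R / 8" R] R by auto
      moreover have "z \<notin> ball y (R / 2)" using False R by auto
      ultimately show ?thesis
        using kern_support[of "R / 8" z x] kern_support[of "R / 2" z y] R by simp
    qed
  qed (use R cv in \<open>auto intro!: integrable_mult_right integrable_kern simp: mult.assoc\<close>)
  also have "\<dots> = 2 * 4 ^ DIM('a) * exp 3 * (\<integral>z. v z * kern y (R / 2) z \<partial>lborel)"
    by simp
  also have "\<dots> \<le> 2 * 4 ^ DIM('a) * exp 3 * (exp (A / R\<^sup>2 * (R / 2)\<^sup>2 / 4) * v y * ?\<kappa>)"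
    using R A f nn by (intro mult_left_mono super_mean_value[OF v, of _ R]) auto
  also have "\<dots> \<le> 2 * 4 ^ DIM('a) * exp 3 * (exp A * v y * ?\<kappa>)"
    using R A nn[of y] kern_mass_pos[where 'a='a]
    by (intro mult_left_mono mult_right_mono) (auto simp: field_simps power2_eq_square)
  finally have "v x * ?\<kappa> \<le> (2 * 4 ^ DIM('a) * exp (3 + A) * v y) * ?\<kappa>"
    by (simp add: exp_add mult_ac)
  then show ?thesis
    using kern_mass_pos[where 'a='a] by (rule mult_right_le_imp_le)
qed

text \<open>
  At a zero of \<open>v\<close> the upper mean value bound is \<open>0\<close>, so \<open>v\<close> vanishes on a neighbourhood; the zero set
  is open and closed in \<open>\<Omega>\<close>.
\<close>

lemma vanishes_everywhere:
  fixes \<Omega> :: "'a::euclidean_space set"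
  assumes v: "weak_poisson \<Omega> v f" and "connected \<Omega>"
    and nn: "\<And>z. z \<in> \<Omega> \<Longrightarrow> 0 \<le> v z"
    and loc: "\<And>x. x \<in> \<Omega> \<Longrightarrow> \<exists>R>0. \<exists>\<Lambda>\<ge>0. cball x R \<subseteq> \<Omega> \<and> (\<forall>z\<in>cball x R. f z \<le> \<Lambda> * v z)"
    and x: "x \<in> \<Omega>" "v x = 0" and y: "y \<in> \<Omega>"
  shows "v y = 0"
proof -
  define Z where "Z = {z \<in> \<Omega>. v z = 0}"
  have "open \<Omega>" and cv: "continuous_on \<Omega> v" using v by (auto simp: weak_poisson_def)
  have "open Z"
    unfolding open_contains_ball
  proof
    fix z assume z: "z \<in> Z"
    then obtain R \<Lambda> where R: "0 < R" "0 \<le> \<Lambda>" "cball z R \<subseteq> \<Omega>" "\<And>a. a \<in> cball z R \<Longrightarrow> f a \<le> \<Lambda> * v a"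
      using loc[of z] by (auto simp: Z_def)
    have in_\<Omega>: "a \<in> \<Omega>" if "dist z a < R" for a using R(3) that by (auto simp: subset_eq)
    have cv': "continuous_on (cball z (R / 2)) v"
      using R by (intro continuous_on_subset[OF cv]) (auto simp: subset_eq)
    have "v a = 0" if a: "a \<in> ball z (R / 2)" for a
    proof (rule ccontr)
      assume "v a \<noteq> 0"
      have "0 < (\<integral>b. v b * kern z (R / 2) b \<partial>lborel)"
      proof (rule integral_pos[OF _ _ _ a])
        show "0 < v a * kern z (R / 2) a"
          using nn[of a] \<open>v a \<noteq> 0\<close> a R in_\<Omega>[of a] by (intro mult_pos_pos kern_pos) (auto simp: less_le)
        show "0 \<le> v b * kern z (R / 2) b" if "b \<in> cball z (R / 2)" for b
          using that R in_\<Omega>[of b] by (intro mult_nonneg_nonneg nn kern_nonneg) auto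
      qed (use R in \<open>auto intro!: continuous_on_mult cv' kern_support elem_smooth_continuous[OF kern_elem_smooth]\<close>)
      also have "\<dots> \<le> exp (\<Lambda> * (R / 2)\<^sup>2 / 4) * v z * (\<integral>z. kern (0::'a) 1 z \<partial>lborel)"
        using R in_\<Omega> by (intro super_mean_value[OF v, of _ R] nn) auto
      also have "\<dots> = 0" using z by (simp add: Z_def)
      finally show False by simp
    qed
    then show "\<exists>e>0. ball z e \<subseteq> Z"
      using R in_\<Omega> by (intro exI[of _ "R / 2"]) (auto simp: Z_def subset_eq)
  qed
  then have "openin (top_of_set \<Omega>) Z"
    by (metis (no_types, lifting) Z_def \<open>open \<Omega>\<close> mem_Collect_eq openin_open_eq subsetI)
  moreover have "closedin (top_of_set \<Omega>) Z"
    unfolding Z_def by (rule continuous_closedin_preimage_constant[OF cv])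
  ultimately have "Z = {} \<or> Z = \<Omega>"
    using \<open>connected \<Omega>\<close> by (auto simp: connected_clopen)
  then show ?thesis using x y by (auto simp: Z_def)
qed

text \<open>
  The functions \<open>pot x r\<close> are test functions whenever the closed ball of radius \<open>r\<close> lies in \<open>\<Omega>\<close>.
\<close>

lemma nonneg_solution_weak_poisson:
  fixes \<Omega> :: "'a::euclidean_space set"
  assumes u: "nonneg_solution \<Omega> g u" and "open \<Omega>"
    and g: "continuous_on (\<Omega> \<times> {0..}) (\<lambda>(x, t). g x t)"
  shows "weak_poisson \<Omega> u (\<lambda>x. g x (u x))"
  unfolding weak_poisson_def
proof (intro conjI allI impI)
  show cu: "continuous_on \<Omega> u" using u by (simp add: nonneg_solution_def)
  have "continuous_on \<Omega> ((\<lambda>(x, t). g x t) \<circ> (\<lambda>x. (x, u x)))"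
    using u cu by (intro continuous_on_compose continuous_on_subset[OF g] continuous_intros)
      (auto simp: nonneg_solution_def)
  then show cf: "continuous_on \<Omega> (\<lambda>x. g x (u x))" by (simp add: o_def)
  fix x r assume xr: "0 < r \<and> cball x r \<subseteq> \<Omega>"
  have supp: "pot x r z = 0" if "z \<notin> cball x r" for z
    using that xr by (intro pot_support) auto
  have int_eq: "(LINT z:\<Omega>|lebesgue. v z * k z) = (\<integral>z. v z * k z \<partial>lborel)"
    if v: "continuous_on \<Omega> v" and k: "elem_smooth k" "\<And>z. z \<notin> cball x r \<Longrightarrow> k z = 0" for v k
  proof -
    have "integrable lborel (\<lambda>z. v z * k z)"
      using xr v k by (intro integrable_local[of x r]) (auto intro: continuous_on_subset elem_smooth_continuous)
    then have "(\<integral>z. v z * k z \<partial>lebesgue) = (\<integral>z. v z * k z \<partial>lborel)"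
      by (intro integral_completion) auto
    moreover have "(\<lambda>z. indicator \<Omega> z *\<^sub>R (v z * k z)) = (\<lambda>z. v z * k z)"
      using k(2) xr by (auto simp: fun_eq_iff indicator_def subset_eq)
    ultimately show ?thesis by (simp add: set_lebesgue_integral_def)
  qed
  have "closure {z. pot x r z \<noteq> 0} \<subseteq> cball x r"
    by (intro closure_minimal) (use supp in \<open>auto simp del: mem_cball\<close>)
  moreover from this have "compact (closure {z. pot x r z \<noteq> 0})"
    by (meson bounded_cball bounded_subset closed_closure compact_eq_bounded_closed)
  ultimately have "test_function \<Omega> (pot x r)"
    using xr by (auto simp: test_function_def elem_smooth_Ck pot_elem_smooth)
  then have "(LINT z:\<Omega>|lebesgue. u z * laplacian (pot x r) z) = (LINT z:\<Omega>|lebesgue. g z (u z) * pot x r z)"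
    using u by (simp add: nonneg_solution_def)
  then show "(\<integral>z. u z * laplacian (pot x r) z \<partial>lborel) = (\<integral>z. g z (u z) * pot x r z \<partial>lborel)"
    using int_eq[OF cu elem_smooth_laplacian[OF pot_elem_smooth] laplacian_support[OF supp]]
      int_eq[OF cf pot_elem_smooth supp] by simp
qed fact

section \<open>Decay at the boundary\<close>

lemma laplacian_gaussian:
  fixes a :: "'a::euclidean_space" and c d \<beta> :: real
  shows "laplacian (\<lambda>z. c * (d - exp (- \<beta> * (norm (z - a))\<^sup>2))) z =
    - c * exp (- \<beta> * (norm (z - a))\<^sup>2) * (4 * \<beta>\<^sup>2 * (norm (z - a))\<^sup>2 - 2 * DIM('a) * \<beta>)"
proof -
  define E where "E z = exp (- \<beta> * (norm (z - a))\<^sup>2)" for z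
  have E: "(E has_derivative (\<lambda>i. E z * (- 2 * \<beta> * ((z - a) \<bullet> i)))) (at z)" for z
  proof -
    have "((\<lambda>z. - \<beta> * (norm (z - a))\<^sup>2) has_derivative (\<lambda>i. - 2 * \<beta> * ((z - a) \<bullet> i))) (at z)"
      unfolding power2_norm_eq_inner
      by (auto intro!: derivative_eq_intros simp: inner_commute algebra_simps)
    from has_derivative_exp[OF this] show ?thesis by (simp add: E_def[abs_def] mult_ac)
  qed
  have "((\<lambda>z. c * (d - E z)) has_derivative (\<lambda>i. c * (0 - E z * (- 2 * \<beta> * ((z - a) \<bullet> i))))) (at z)" for z
    by (intro has_derivative_mult_right has_derivative_diff has_derivative_const E)
  then have 1: "partial_deriv i (\<lambda>z. c * (d - E z)) = (\<lambda>z. c * (0 - E z * (- 2 * \<beta> * ((z - a) \<bullet> i))))" for i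
    by (intro ext partial_deriv_eq)
  have 2: "partial_deriv i (partial_deriv i (\<lambda>z. c * (d - E z))) z =
      - c * E z * (4 * \<beta>\<^sup>2 * ((z - a) \<bullet> i)\<^sup>2 - 2 * \<beta>)" if "i \<in> Basis" for i
  proof -
    have "((\<lambda>z. - 2 * \<beta> * ((z - a) \<bullet> i)) has_derivative (\<lambda>j. - 2 * \<beta> * (j \<bullet> i))) (at z)"
      by (auto intro!: derivative_eq_intros)
    from has_derivative_mult_right[OF has_derivative_diff[OF has_derivative_const has_derivative_mult[OF E this]]]
    have "((\<lambda>z. c * (0 - E z * (- 2 * \<beta> * ((z - a) \<bullet> i)))) has_derivative
      (\<lambda>j. c * (0 - (E z * (- 2 * \<beta> * (j \<bullet> i)) +
        E z * (- 2 * \<beta> * ((z - a) \<bullet> j)) * (- 2 * \<beta> * ((z - a) \<bullet> i)))))) (at z)" .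
    from partial_deriv_eq[OF this, of i] that show ?thesis
      unfolding 1 by (simp add: power2_eq_square algebra_simps)
  qed
  have n: "(norm (z - a))\<^sup>2 = (\<Sum>i\<in>Basis. ((z - a) \<bullet> i)\<^sup>2)"
    unfolding power2_norm_eq_inner by (subst euclidean_inner) (simp add: power2_eq_square)
  have "laplacian (\<lambda>z. c * (d - E z)) z = (\<Sum>i\<in>Basis. - c * E z * (4 * \<beta>\<^sup>2 * ((z - a) \<bullet> i)\<^sup>2 - 2 * \<beta>))"
    unfolding laplacian_def using 2 by (rule sum.cong[OF refl])
  also have "\<dots> = - c * E z * (4 * \<beta>\<^sup>2 * (norm (z - a))\<^sup>2 - 2 * DIM('a) * \<beta>)"
    unfolding n by (simp only: sum_distrib_left[symmetric] sum_subtractf sum_constant) (simp add: mult_ac)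
  finally show ?thesis by (simp add: E_def)
qed

text \<open>
  The function \<open>h\<close> is the height over the boundary graph in the direction \<open>e\<close>. It is a Lipschitz function
  on the whole space which describes \<open>\<Omega>\<close> only inside the ball. The centre of the ball is arbitrary, so
  that charts can be restricted to balls around interior points.
\<close>

definition graph_chart ::
  "'a::euclidean_space set \<Rightarrow> 'a \<Rightarrow> real \<Rightarrow> 'a \<Rightarrow> ('a \<Rightarrow> real) \<Rightarrow> real \<Rightarrow> bool" where
  "graph_chart \<Omega> P \<rho> e h \<Lambda> \<longleftrightarrow> norm e = 1 \<and> 1 \<le> \<Lambda> \<and> (\<forall>y s. h (y + s *\<^sub>R e) = h y + s) \<and>
     (\<forall>y z. \<bar>h y - h z\<bar> \<le> \<Lambda> * dist y z) \<and> (\<forall>y\<in>ball P \<rho>. y \<in> \<Omega> \<longleftrightarrow> 0 < h y)"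

text \<open>
  The barrier of \<open>decay_step\<close> is \<open>exp (- N) - exp (- \<beta> \<rho>\<^sup>2)\<close> with \<open>\<beta> t\<^sup>2 = N \<Lambda>\<^sup>2\<close>, \<open>\<rho>\<close> being the distance to the centre of
  an exterior ball of radius \<open>t / \<Lambda>\<close>. The factor is the quotient of its values at \<open>\<rho> = 3 t\<close> and \<open>\<rho> = 4 t\<close>.
\<close>

definition decay_factor :: "'a::euclidean_space itself \<Rightarrow> real \<Rightarrow> real" where
  "decay_factor _ \<Lambda> = (exp (- real DIM('a)) - exp (- (9 * real DIM('a) * \<Lambda>\<^sup>2)))
     / (exp (- real DIM('a)) - exp (- (16 * real DIM('a) * \<Lambda>\<^sup>2)))"

lemma decay_factor_bounds:
  assumes "1 \<le> \<Lambda>"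
  shows "0 \<le> decay_factor TYPE('a::euclidean_space) \<Lambda>" "decay_factor TYPE('a) \<Lambda> < 1"
proof -
  have l: "1 \<le> \<Lambda>\<^sup>2" using assms by simp
  have "real DIM('a) * 1 < 9 * real DIM('a) * \<Lambda>\<^sup>2" "9 * real DIM('a) * \<Lambda>\<^sup>2 < 16 * real DIM('a) * \<Lambda>\<^sup>2"
    using l DIM_positive[where 'a='a] by (auto simp: mult_less_le_imp_less intro!: mult_strict_right_mono)
  then have "exp (- real DIM('a)) > exp (- (9 * real DIM('a) * \<Lambda>\<^sup>2))"
    "exp (- (9 * real DIM('a) * \<Lambda>\<^sup>2)) > exp (- (16 * real DIM('a) * \<Lambda>\<^sup>2))"
    by auto
  then show "0 \<le> decay_factor TYPE('a::euclidean_space) \<Lambda>" "decay_factor TYPE('a) \<Lambda> < 1"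
    unfolding decay_factor_def by (auto simp: field_simps)
qed

text \<open>
  A subharmonic function which vanishes continuously on the part of the boundary inside a chart;
  \<open>U\<close> is its extension by zero.
\<close>

locale vanishing_subharmonic =
  fixes \<Omega> :: "'a::euclidean_space set" and u f :: "'a \<Rightarrow> real" and U :: "'a \<Rightarrow> real"
    and P e :: 'a and \<rho> \<Lambda> :: real and h :: "'a \<Rightarrow> real"
  assumes poisson: "weak_poisson \<Omega> u f"
    and rhs_nonneg: "\<And>z. z \<in> \<Omega> \<Longrightarrow> 0 \<le> f z"
    and chart: "graph_chart \<Omega> P \<rho> e h \<Lambda>"
    and U_cont: "continuous_on (closure \<Omega> \<inter> ball P \<rho>) U"
    and U_eq: "\<And>z. z \<in> \<Omega> \<Longrightarrow> U z = u z"
    and U_zero: "\<And>z. z \<notin> \<Omega> \<Longrightarrow> U z = 0"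
begin

lemma norm_e: "norm e = 1" and \<Lambda>_ge_1: "1 \<le> \<Lambda>" and h_shift: "h (y + s *\<^sub>R e) = h y + s"
  and h_lip: "\<bar>h y - h z\<bar> \<le> \<Lambda> * dist y z" and h_iff: "y \<in> ball P \<rho> \<Longrightarrow> y \<in> \<Omega> \<longleftrightarrow> 0 < h y"
  using chart by (auto simp: graph_chart_def)

lemma open_\<Omega>: "open \<Omega>"
  using poisson by (simp add: weak_poisson_def)

text \<open>
  Moving from \<open>y\<close> by \<open>h y + t\<close> against \<open>e\<close> leads to a point \<open>y'\<close> of height \<open>- t\<close>, so the ball of radius \<open>t / \<Lambda>\<close>
  around \<open>y'\<close> avoids \<open>\<Omega>\<close>. Outside that ball a Gaussian centred at \<open>y'\<close> that is steep enough is
  subharmonic, and a constant minus a multiple of it is a superharmonic barrier for \<open>u\<close> in the part of \<open>\<Omega>\<close>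
  within distance \<open>4 t\<close> of \<open>y'\<close>.
\<close>

lemma decay_step:
  assumes y: "y \<in> \<Omega>" "h y \<le> t" and t: "0 < t" "cball y (6 * t) \<subseteq> ball P \<rho>" and S: "0 \<le> S"
    and bound: "\<And>z. z \<in> \<Omega> \<Longrightarrow> dist y z \<le> 6 * t \<Longrightarrow> u z \<le> S"
    and z: "z \<in> \<Omega>" "dist y z \<le> t"
  shows "u z \<le> decay_factor TYPE('a) \<Lambda> * S"
proof -
  let ?N = "real DIM('a)"
  have "y \<in> ball P \<rho>" using t by (auto simp: subset_eq)
  then have hy: "0 < h y" using h_iff y by simp
  define y' where "y' = y + (- (h y + t)) *\<^sub>R e"
  have hy': "h y' = - t" unfolding y'_def h_shift by simp
  have dyy: "dist y y' \<le> 2 * t"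
    using norm_e hy y t by (simp add: y'_def dist_norm)
  have near: "dist y p \<le> 6 * t" if "dist y' p \<le> 4 * t" for p
    using dist_triangle[of y p y'] dyy that by simp
  have ext: "t / \<Lambda> \<le> dist y' p" if "p \<in> \<Omega>" "dist y' p \<le> 4 * t" for p
  proof -
    have "0 < h p" using that near[OF that(2)] h_iff t(2) by (auto simp: subset_eq)
    then have "t \<le> \<Lambda> * dist y' p" using h_lip[of y' p] hy' by linarith
    then show ?thesis using \<Lambda>_ge_1 by (simp add: field_simps)
  qed
  define \<beta> where "\<beta> = ?N * \<Lambda>\<^sup>2 / t\<^sup>2"
  have \<beta>: "0 \<le> \<beta>" by (simp add: \<beta>_def)
  define c where "c = S / (exp (- ?N) - exp (- (16 * ?N * \<Lambda>\<^sup>2)))"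
  define w where "w z = c * (exp (- ?N) - exp (- \<beta> * (norm (z - y'))\<^sup>2))" for z
  have "1 \<le> \<Lambda>\<^sup>2" using \<Lambda>_ge_1 by simp
  then have "?N * 1 < 16 * ?N * \<Lambda>\<^sup>2"
    using DIM_positive[where 'a='a] by (auto simp: mult_less_le_imp_less)
  then have c_den: "0 < exp (- ?N) - exp (- (16 * ?N * \<Lambda>\<^sup>2))" by simp
  have c: "0 \<le> c" using S c_den by (simp add: c_def)
  have \<beta>_le: "?N \<le> \<beta> * (norm (p - y'))\<^sup>2" if "t / \<Lambda> \<le> dist y' p" for p
  proof -
    have "?N = \<beta> * (t / \<Lambda>)\<^sup>2" using t \<Lambda>_ge_1 by (simp add: \<beta>_def field_simps)
    also have "\<dots> \<le> \<beta> * (norm (p - y'))\<^sup>2"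
      using that t \<Lambda>_ge_1 \<beta> by (intro mult_left_mono power_mono) (auto simp: dist_norm norm_minus_commute)
    finally show ?thesis .
  qed
  have "w = (\<lambda>z. c * (exp (- ?N) + (- 1) * exp (- \<beta> * (norm (z - y'))\<^sup>2)))"
    by (auto simp: w_def)
  then have w_smooth: "elem_smooth w"
    by (simp only:) (intro elem_smooth.intros)
  have w_lap: "laplacian w p \<le> 0" if "t / \<Lambda> \<le> dist y' p" for p
  proof -
    have "?N * \<beta> \<le> \<beta> * (norm (p - y'))\<^sup>2 * \<beta>"
      using \<beta>_le[OF that] \<beta> by (intro mult_right_mono) auto
    moreover have "0 \<le> ?N * \<beta>" using \<beta> by simp
    ultimately have "0 \<le> 4 * \<beta>\<^sup>2 * (norm (p - y'))\<^sup>2 - 2 * ?N * \<beta>"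
      by (simp add: power2_eq_square mult_ac)
    then show ?thesis
      unfolding w_def[abs_def] laplacian_gaussian using c by (simp add: mult_nonneg_nonneg)
  qed
  define D where "D = \<Omega> \<inter> ball y' (4 * t)"
  have D: "open D" "bounded D" "D \<subseteq> \<Omega>" using open_\<Omega> by (auto simp: D_def)
  have cl: "p \<in> closure \<Omega>" "dist y' p \<le> 4 * t" if "p \<in> closure D" for p
  proof -
    show "p \<in> closure \<Omega>" using that closure_mono[of D \<Omega>] by (auto simp: D_def)
    have "closure D \<subseteq> cball y' (4 * t)" by (intro closure_minimal) (auto simp: D_def)
    with that show "dist y' p \<le> 4 * t" by auto
  qed
  have cl': "p \<in> ball P \<rho>" if "p \<in> closure D" for p
    using near[OF cl(2)[OF that]] t(2) by (auto simp: subset_eq)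
  have "z \<in> D"
    using z dist_triangle[of y' z y] dyy t by (simp add: D_def dist_commute)
  have "U z - w z \<le> 0"
  proof (rule max_principle[OF weak_poisson_diff[OF poisson w_smooth] D _ _ _ _ \<open>z \<in> D\<close>])
    show "0 \<le> f p - laplacian w p" if "p \<in> D" for p
      using rhs_nonneg[of p] w_lap[OF ext[of p]] that by (auto simp: D_def)
    show "continuous_on (closure D) (\<lambda>p. U p - w p)"
      using cl cl' by (intro continuous_intros continuous_on_subset[OF U_cont] elem_smooth_continuous w_smooth) auto
    show "U p - w p = u p - w p" if "p \<in> D" for p using that U_eq by (simp add: D_def)
    show "U p - w p \<le> 0" if p: "p \<in> frontier D" for p
    proof (cases "p \<in> \<Omega>")
      case True
      have "p \<in> closure D" "p \<notin> D" using p D(1) by (auto simp: frontier_def interior_open)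
      then have d: "dist y' p = 4 * t" using cl(2)[of p] True by (auto simp: D_def)
      have "\<beta> * (norm (p - y'))\<^sup>2 = 16 * ?N * \<Lambda>\<^sup>2"
        using d t by (simp add: \<beta>_def dist_norm norm_minus_commute power_mult_distrib)
      then have "w p = S" using c_den by (simp add: w_def c_def)
      then show ?thesis using bound[OF True near] d U_eq[OF True] by simp
    next
      case False
      have "t / \<Lambda> \<le> dist y' p"
      proof -
        have "closure D \<subseteq> {p. t / \<Lambda> \<le> dist y' p}"
          by (intro closure_minimal closed_Collect_le continuous_intros) (use ext in \<open>auto simp: D_def\<close>)
        then show ?thesis using p by (auto simp: frontier_def)
      qed
      then have "0 \<le> w p" unfolding w_def using \<beta>_le[of p] c by (intro mult_nonneg_nonneg) auto
      then show ?thesis using U_zero[OF False] by simp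
    qed
  qed
  also have "U z = u z" using U_eq z by simp
  finally have "u z \<le> w z" by simp
  also have "w z \<le> c * (exp (- ?N) - exp (- (9 * ?N * \<Lambda>\<^sup>2)))"
  proof -
    have "norm (z - y') \<le> 3 * t"
      using dist_triangle[of y' z y] dyy z by (simp add: dist_commute dist_norm norm_minus_commute)
    then have "\<beta> * (norm (z - y'))\<^sup>2 \<le> \<beta> * (3 * t)\<^sup>2" using \<beta> by (intro mult_left_mono power_mono) auto
    also have "\<dots> = 9 * ?N * \<Lambda>\<^sup>2" using t by (simp add: \<beta>_def power_mult_distrib)
    finally show ?thesis unfolding w_def using c by (intro mult_left_mono) auto
  qed
  also have "\<dots> = decay_factor TYPE('a) \<Lambda> * S" by (simp add: c_def decay_factor_def)
  finally show ?thesis .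
qed

lemma decay:
  assumes "y \<in> \<Omega>" "h y \<le> t" "0 < t" "cball y (6 ^ k * t) \<subseteq> ball P \<rho>" "0 \<le> S"
    and "\<And>z. z \<in> \<Omega> \<Longrightarrow> dist y z \<le> 6 ^ k * t \<Longrightarrow> u z \<le> S"
    and "z \<in> \<Omega>" "dist y z \<le> t"
  shows "u z \<le> decay_factor TYPE('a) \<Lambda> ^ k * S"
  using assms(2-4,6-8)
proof (induction k arbitrary: t z)
  case (Suc k)
  let ?\<theta> = "decay_factor TYPE('a) \<Lambda>"
  have "1 * (6 * t) \<le> 6 ^ k * (6 * t)" using Suc.prems(2) by (intro mult_right_mono) auto
  then have sub: "cball y (6 * t) \<subseteq> ball P \<rho>"
    using Suc.prems(3) by (auto simp: subset_eq mult_ac)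
  have "u a \<le> ?\<theta> ^ k * S" if "a \<in> \<Omega>" "dist y a \<le> 6 * t" for a
    using Suc.IH[of "6 * t" a] Suc.prems that by (simp add: mult_ac)
  then have "u z \<le> ?\<theta> * (?\<theta> ^ k * S)"
    using Suc.prems sub assms(1,5) decay_factor_bounds[OF \<Lambda>_ge_1, where 'a='a]
    by (intro decay_step[of y t]) auto
  then show ?case by (simp add: mult_ac)
qed simp

end

section \<open>Carleson estimate\<close>

text \<open>
  A nonnegative function as before that satisfies a Harnack inequality at the scale of the distance to
  the complement, near an interior point \<open>x\<close> of height at most \<open>r\<close>. The factor \<open>100\<close> leaves room for the
  Harnack chains, which climb to height about \<open>12 \<Lambda> r\<close>.
\<close>

locale harnack_chart = vanishing_subharmonic \<Omega> u f U x e \<rho> \<Lambda> h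
  for \<Omega> :: "'a::euclidean_space set" and u f U x e \<rho> \<Lambda> h +
  fixes K r :: real
  assumes x_in: "x \<in> \<Omega>" and r_pos: "0 < r" and \<rho>: "\<rho> = 100 * \<Lambda> * r" and h_x: "h x \<le> r"
    and K_ge_1: "1 \<le> K" and u_nonneg: "\<And>z. z \<in> \<Omega> \<Longrightarrow> 0 \<le> u z"
    and harnack_step: "\<And>a b. a \<in> \<Omega> \<Longrightarrow> b \<in> \<Omega> \<Longrightarrow> dist a b \<le> bdist \<Omega> b / 8 \<Longrightarrow> u a \<le> K * u b"
    and compl_ne: "- \<Omega> \<noteq> {}"
begin

lemma r_le: "r \<le> \<Lambda> * r"
  using \<Lambda>_ge_1 r_pos by simp

lemma in_chart_ball: "dist x y \<le> 40 * \<Lambda> * r \<Longrightarrow> y \<in> ball x \<rho>"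
proof -
  assume "dist x y \<le> 40 * \<Lambda> * r"
  then have "dist x y < \<rho>" using r_le r_pos \<rho> by linarith
  then show ?thesis by simp
qed

lemma near_center: "dist x y \<le> r \<Longrightarrow> dist x y \<le> 40 * \<Lambda> * r"
  using r_le r_pos by linarith

lemma in_\<Omega>_iff: "dist x y \<le> 40 * \<Lambda> * r \<Longrightarrow> y \<in> \<Omega> \<longleftrightarrow> 0 < h y"
  by (rule h_iff[OF in_chart_ball])

lemma h_x_pos: "0 < h x"
  using in_\<Omega>_iff[OF near_center, of x] x_in r_pos by simp

text \<open>
  The height is Lipschitz and nonpositive off \<open>\<Omega>\<close> inside the chart. Points outside the chart are too far
  away to matter.
\<close>

lemma bdist_lower:
  assumes y: "dist x y \<le> 40 * \<Lambda> * r"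
  shows "h y / \<Lambda> \<le> bdist \<Omega> y"
proof -
  have "\<Lambda> * dist y x \<le> \<Lambda> * (40 * \<Lambda> * r)"
    using y \<Lambda>_ge_1 by (intro mult_left_mono) (auto simp: dist_commute)
  then have "h y \<le> r + \<Lambda> * (40 * \<Lambda> * r)"
    using h_lip[of y x] h_x by linarith
  also have "\<dots> \<le> \<Lambda> * (\<Lambda> * r) + \<Lambda> * (40 * \<Lambda> * r)"
    using r_le \<Lambda>_ge_1 r_pos mult_right_mono[of 1 \<Lambda> "\<Lambda> * r"] by linarith
  finally have hy: "h y / \<Lambda> \<le> 41 * \<Lambda> * r" using \<Lambda>_ge_1 by (simp add: field_simps)
  have "h y / \<Lambda> \<le> dist y p" if p: "p \<notin> \<Omega>" for p
  proof (cases "p \<in> ball x \<rho>")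
    case True
    then have "h p \<le> 0" using h_iff p by auto
    then have "h y \<le> \<Lambda> * dist y p" using h_lip[of y p] by linarith
    then show ?thesis using \<Lambda>_ge_1 by (simp add: field_simps)
  next
    case False
    then have "100 * \<Lambda> * r \<le> dist x y + dist y p"
      using dist_triangle[of x p y] \<rho> by simp
    with y hy r_le r_pos show ?thesis by linarith
  qed
  then show ?thesis
    using compl_ne by (auto simp: bdist_def infdist_def intro!: cINF_greatest)
qed

lemma harnack_segment:
  assumes d: "0 < d" and seg: "\<And>p. p \<in> closed_segment a b \<Longrightarrow> d \<le> bdist \<Omega> p"
    and n: "dist a b \<le> real n * (d / 8)"
  shows "u a \<le> K ^ n * u b"
  using seg n
proof (induction n arbitrary: a)
  case 0
  then show ?case by simp
next
  case (Suc n)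
  have in_\<Omega>: "p \<in> \<Omega>" if "d \<le> bdist \<Omega> p" for p
    using that d by (cases "p \<in> \<Omega>") (auto simp: bdist_def)
  have ab: "d \<le> bdist \<Omega> a" "d \<le> bdist \<Omega> b" using Suc.prems(1) by auto
  have "1 \<le> K ^ n" using K_ge_1 by simp
  show ?case
  proof (cases "dist a b \<le> d / 8")
    case True
    then have "u a \<le> K * u b" using ab by (intro harnack_step in_\<Omega>) auto
    also have "\<dots> \<le> K * (K ^ n * u b)"
      using \<open>1 \<le> K ^ n\<close> K_ge_1 u_nonneg[OF in_\<Omega>[OF ab(2)]] by (intro mult_left_mono) (auto simp: mult_le_cancel_right1)
    finally show ?thesis by (simp add: mult_ac)
  next
    case False
    define \<tau> where "\<tau> = d / 8 / dist a b"
    define c where "c = a + \<tau> *\<^sub>R (b - a)"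
    have D: "0 < dist a b" using False d by linarith
    then have \<tau>: "0 \<le> \<tau>" "\<tau> \<le> 1" using False d by (auto simp: \<tau>_def field_simps)
    have c_seg: "c \<in> closed_segment a b"
      using \<tau> by (auto simp: c_def closed_segment_def algebra_simps intro!: exI[of _ \<tau>])
    have ac: "dist a c = d / 8"
      using D \<tau> by (simp add: c_def dist_norm norm_minus_commute) (simp add: \<tau>_def dist_norm norm_minus_commute)
    have "b - c = (1 - \<tau>) *\<^sub>R (b - a)" by (simp add: c_def algebra_simps)
    then have "dist c b = (1 - \<tau>) * dist a b"
      using \<tau> by (simp add: dist_norm norm_minus_commute)
    also have "\<dots> = dist a b - d / 8" using D by (simp add: \<tau>_def field_simps)
    also have "\<dots> \<le> real n * (d / 8)" using Suc.prems(2) by (simp add: algebra_simps)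
    finally have cb: "dist c b \<le> real n * (d / 8)" .
    have "closed_segment c b \<subseteq> closed_segment a b"
      using c_seg by (simp add: subset_closed_segment)
    then have "u c \<le> K ^ n * u b" using Suc.prems(1) cb by (intro Suc.IH) auto
    moreover have "u a \<le> K * u c"
      using Suc.prems(1)[OF c_seg] ab ac by (intro harnack_step in_\<Omega>) auto
    moreover have "K * u c \<le> K * (K ^ n * u b)"
      using calculation(1) K_ge_1 by (intro mult_left_mono) auto
    ultimately have "u a \<le> K * (K ^ n * u b)" by linarith
    then show ?thesis by (simp add: mult.assoc)
  qed
qed

lemma h_upper:
  assumes "dist x y \<le> r"
  shows "h y \<le> 2 * \<Lambda> * r"
proof -
  have "\<Lambda> * dist y x \<le> \<Lambda> * r"
    using assms \<Lambda>_ge_1 by (intro mult_left_mono) (auto simp: dist_commute)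
  then show ?thesis using h_lip[of y x] h_x r_le by linarith
qed

lemma dist_shift: "0 \<le> s \<Longrightarrow> dist x (y + s *\<^sub>R e) \<le> dist x y + s"
  using dist_triangle[of x "y + s *\<^sub>R e" y] norm_e by (simp add: dist_norm)

text \<open>
  Moving upwards by the fraction \<open>1 / (8 \<Lambda>)\<close> of the current height is a single Harnack step: it multiplies
  the height by \<open>q = 1 + 1 / (8 \<Lambda>)\<close> and costs a factor \<open>K \<le> q ^ p\<close>, so \<open>u * h ^ p\<close> does not decrease along
  the way up.
\<close>

lemma climb:
  assumes y: "y \<in> \<Omega>" "dist x y \<le> r" and K: "K \<le> (1 + 1 / (8 * \<Lambda>)) ^ p"
  shows "\<exists>s. 6 * \<Lambda> * r \<le> s \<and> s \<le> 12 * \<Lambda> * r \<and> u y * h y ^ p \<le> u (y + (s - h y) *\<^sub>R e) * s ^ p"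
proof -
  define q where "q = 1 + 1 / (8 * \<Lambda>)"
  have q: "1 < q" "q \<le> 2" using \<Lambda>_ge_1 by (auto simp: q_def field_simps)
  have hy: "0 < h y" using in_\<Omega>_iff[OF near_center, of y] y by auto
  define Y where "Y n = y + (h y * q ^ n - h y) *\<^sub>R e" for n :: nat
  have hY: "h (Y n) = h y * q ^ n" for n by (simp add: Y_def h_shift)
  have ge: "h y \<le> h y * q ^ n" for n using hy q by simp
  have dY: "dist x (Y n) \<le> 40 * \<Lambda> * r" if "h y * q ^ n \<le> 12 * \<Lambda> * r" for n
    using dist_shift[of "h y * q ^ n - h y" y] ge[of n] that y(2) r_le r_pos hy
    unfolding Y_def by linarith
  have Y_in: "Y n \<in> \<Omega>" if "h y * q ^ n \<le> 12 * \<Lambda> * r" for n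
    using in_\<Omega>_iff[OF dY[OF that]] hY hy q by simp
  have step: "u y * h y ^ p \<le> u (Y n) * h (Y n) ^ p" if "h y * q ^ n \<le> 12 * \<Lambda> * r" for n
    using that
  proof (induction n)
    case 0
    then show ?case by (simp add: Y_def)
  next
    case (Suc n)
    have le: "h y * q ^ n \<le> h y * q ^ Suc n" using q hy by simp
    then have n: "h y * q ^ n \<le> 12 * \<Lambda> * r" using Suc.prems by linarith
    have "Y n - Y (Suc n) = - (h y * q ^ n * (q - 1)) *\<^sub>R e"
      by (simp add: Y_def algebra_simps)
    then have "dist (Y n) (Y (Suc n)) = h y * q ^ n * (q - 1)"
      using norm_e hy q by (simp add: dist_norm)
    also have "\<dots> \<le> h y * q ^ Suc n * (q - 1)" using q hy by (intro mult_right_mono le) auto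
    also have "\<dots> = h (Y (Suc n)) / \<Lambda> / 8" by (simp add: hY q_def)
    also have "\<dots> \<le> bdist \<Omega> (Y (Suc n)) / 8"
      using bdist_lower[OF dY[OF Suc.prems]] by simp
    finally have "u (Y n) \<le> K * u (Y (Suc n))"
      by (intro harnack_step Y_in n Suc.prems)
    then have "u (Y n) * h (Y n) ^ p \<le> K * u (Y (Suc n)) * h (Y n) ^ p"
      using hy q by (intro mult_right_mono) (auto simp: hY)
    also have "\<dots> \<le> q ^ p * u (Y (Suc n)) * h (Y n) ^ p"
      using hy q K u_nonneg[OF Y_in[OF Suc.prems]] by (intro mult_right_mono) (auto simp: hY q_def)
    also have "\<dots> = u (Y (Suc n)) * h (Y (Suc n)) ^ p"
      by (simp add: hY power_mult_distrib mult_ac)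
    finally show ?case using Suc.IH[OF n] by linarith
  qed
  obtain n0 where "6 * \<Lambda> * r / h y < q ^ n0" using real_arch_pow[OF q(1)] by blast
  then have ex: "6 * \<Lambda> * r \<le> h y * q ^ n0" using hy by (simp add: field_simps)
  define n where "n = (LEAST n. 6 * \<Lambda> * r \<le> h y * q ^ n)"
  have n: "6 * \<Lambda> * r \<le> h y * q ^ n" unfolding n_def using ex by (rule LeastI)
  have "h y < 6 * \<Lambda> * r" using h_upper[OF y(2)] r_le r_pos by linarith
  then obtain m where m: "n = Suc m" using n by (cases n) auto
  then have "\<not> 6 * \<Lambda> * r \<le> h y * q ^ m" using not_less_Least[of m "\<lambda>n. 6 * \<Lambda> * r \<le> h y * q ^ n"] by (simp add: n_def)
  then have "h y * q ^ m * q \<le> (6 * \<Lambda> * r) * 2"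
    using q hy \<Lambda>_ge_1 r_pos by (intro mult_mono[of _ "6 * \<Lambda> * r"]) auto
  moreover have "h y * q ^ n = h y * q ^ m * q" by (simp add: m)
  ultimately have n': "h y * q ^ n \<le> 12 * \<Lambda> * r" by linarith
  show ?thesis
    using step[OF n'] n n' unfolding hY by (intro exI[of _ "h y * q ^ n"]) (simp only: Y_def simp_thms)
qed

text \<open>
  The chain climbs from \<open>y\<close> to a point \<open>T\<close> of height about \<open>6 \<Lambda> r\<close>, runs from there to the point \<open>Z\<close> above \<open>z\<close>,
  and descends to \<open>z\<close>. At that height the segment from \<open>T\<close> to \<open>Z\<close> stays at distance at least \<open>2 r\<close> from the
  complement, whatever the Lipschitz graph does, and the descent stays above the height of \<open>z\<close>. So both
  segments need only a number \<open>n\<close> of Harnack steps that depends on \<open>\<Lambda>\<close> and \<open>\<epsilon>\<close>.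
\<close>

lemma interior_comparison:
  assumes y: "y \<in> \<Omega>" "dist x y \<le> r" and K: "K \<le> (1 + 1 / (8 * \<Lambda>)) ^ p"
    and z: "dist x z = r" "\<epsilon> * r \<le> bdist \<Omega> z" "0 < \<epsilon>"
    and n: "32 * \<Lambda> \<le> real n" "48 * \<Lambda>\<^sup>2 \<le> real n * \<epsilon>"
  shows "u y * h y ^ p \<le> K ^ (2 * n) * u z * (12 * \<Lambda> * r) ^ p"
proof -
  obtain s where s: "6 * \<Lambda> * r \<le> s" "s \<le> 12 * \<Lambda> * r"
    "u y * h y ^ p \<le> u (y + (s - h y) *\<^sub>R e) * s ^ p"
    using climb[OF y K] by blast
  define T where "T = y + (s - h y) *\<^sub>R e"
  define Z where "Z = z + (6 * \<Lambda> * r) *\<^sub>R e"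
  have hy: "0 < h y" "h y \<le> 2 * \<Lambda> * r" using in_\<Omega>_iff[OF near_center, of y] y h_upper[of y] by auto
  have dyz: "dist y z \<le> 2 * r" using dist_triangle[of y z x] y z by (simp add: dist_commute)
  have TZ: "u T \<le> K ^ n * u Z"
  proof (rule harnack_segment)
    show "0 < 2 * r" using r_pos by simp
    fix p assume "p \<in> closed_segment T Z"
    then obtain \<tau> where \<tau>: "0 \<le> \<tau>" "\<tau> \<le> 1" "p = (1 - \<tau>) *\<^sub>R T + \<tau> *\<^sub>R Z"
      by (auto simp: closed_segment_def)
    define \<sigma> where "\<sigma> = (1 - \<tau>) * (s - h y) + \<tau> * (6 * \<Lambda> * r)"
    define b where "b = (1 - \<tau>) *\<^sub>R y + \<tau> *\<^sub>R z"
    have p: "p = b + \<sigma> *\<^sub>R e" by (simp add: \<tau>(3) \<sigma>_def b_def T_def Z_def algebra_simps)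
    have "4 * \<Lambda> * r = (1 - \<tau>) * (4 * \<Lambda> * r) + \<tau> * (4 * \<Lambda> * r)" by (simp add: algebra_simps)
    also have "\<dots> \<le> \<sigma>"
      unfolding \<sigma>_def using \<tau> s hy r_le r_pos by (intro add_mono mult_left_mono) auto
    finally have \<sigma>1: "4 * \<Lambda> * r \<le> \<sigma>" .
    have "\<sigma> \<le> (1 - \<tau>) * (12 * \<Lambda> * r) + \<tau> * (12 * \<Lambda> * r)"
      unfolding \<sigma>_def using \<tau> s hy r_le r_pos by (intro add_mono mult_left_mono) auto
    then have \<sigma>2: "\<sigma> \<le> 12 * \<Lambda> * r" by (simp add: algebra_simps)
    have "b \<in> cball x r"
      unfolding b_def using y z \<tau> by (intro convexD[OF convex_cball]) auto
    then have xb: "dist x b \<le> r" by simp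
    have "b - y = \<tau> *\<^sub>R (z - y)" by (simp add: b_def algebra_simps)
    then have "dist y b = \<tau> * dist y z" using \<tau> by (simp add: dist_norm norm_minus_commute)
    also have "\<dots> \<le> 1 * (2 * r)" using \<tau> dyz by (intro mult_mono) auto
    finally have "\<Lambda> * dist y b \<le> \<Lambda> * (2 * r)" using \<Lambda>_ge_1 by (intro mult_left_mono) auto
    then have "- (2 * \<Lambda> * r) \<le> h b" using h_lip[of y b] hy by simp
    then have hp: "2 * \<Lambda> * r \<le> h p" using \<sigma>1 by (simp add: p h_shift)
    have "0 \<le> \<sigma>" using \<sigma>1 r_le r_pos by linarith
    then have "dist x p \<le> 40 * \<Lambda> * r"
      using dist_shift[of \<sigma> b] xb \<sigma>2 r_le r_pos unfolding p by linarith
    from bdist_lower[OF this] have "h p / \<Lambda> \<le> bdist \<Omega> p" .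
    moreover have "2 * r \<le> h p / \<Lambda>"
      using hp \<Lambda>_ge_1 by (simp add: pos_le_divide_eq mult_ac)
    ultimately show "2 * r \<le> bdist \<Omega> p" by linarith
  next
    have "T - Z = (y - z) + (s - h y - 6 * \<Lambda> * r) *\<^sub>R e" by (simp add: T_def Z_def algebra_simps)
    then have "dist T Z \<le> dist y z + \<bar>s - h y - 6 * \<Lambda> * r\<bar>"
      using norm_triangle_ineq[of "y - z" "(s - h y - 6 * \<Lambda> * r) *\<^sub>R e"] norm_e by (simp add: dist_norm)
    also have "\<dots> \<le> 8 * \<Lambda> * r" using dyz s hy r_le r_pos by linarith
    also have "\<dots> = 32 * \<Lambda> * (2 * r / 8)" by simp
    also have "\<dots> \<le> real n * (2 * r / 8)" using n r_pos by (intro mult_right_mono) auto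
    finally show "dist T Z \<le> real n * (2 * r / 8)" .
  qed
  have "0 < bdist \<Omega> z" using z r_pos by (meson less_le_trans mult_pos_pos)
  then have z_in: "z \<in> \<Omega>" by (cases "z \<in> \<Omega>") (auto simp: bdist_def)
  have hz: "bdist \<Omega> z \<le> h z"
  proof -
    have hz: "0 < h z" "h z \<le> 2 * \<Lambda> * r" using in_\<Omega>_iff[OF near_center, of z] z z_in h_upper[of z] by auto
    define b where "b = z + (- h z) *\<^sub>R e"
    have "dist z b = h z" using norm_e hz by (simp add: b_def dist_norm)
    moreover have "dist x b \<le> 40 * \<Lambda> * r"
      using dist_triangle[of x b z] z hz calculation r_le r_pos by linarith
    then have "b \<notin> \<Omega>" using in_\<Omega>_iff[of b] h_shift[of z "- h z"] by (simp add: b_def)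
    ultimately show ?thesis using infdist_le[of b "- \<Omega>" z] by (simp add: bdist_def)
  qed
  have Zz: "u Z \<le> K ^ n * u z"
  proof (rule harnack_segment)
    show "0 < \<epsilon> * r / \<Lambda>" using z r_pos \<Lambda>_ge_1 by simp
    fix p assume "p \<in> closed_segment Z z"
    then obtain \<tau> where \<tau>: "0 \<le> \<tau>" "\<tau> \<le> 1" "p = (1 - \<tau>) *\<^sub>R Z + \<tau> *\<^sub>R z"
      by (auto simp: closed_segment_def)
    define \<sigma> where "\<sigma> = (1 - \<tau>) * (6 * \<Lambda> * r)"
    have p: "p = z + \<sigma> *\<^sub>R e" by (simp add: \<tau>(3) \<sigma>_def Z_def algebra_simps)
    have "\<sigma> \<le> 1 * (6 * \<Lambda> * r)" unfolding \<sigma>_def using \<tau> \<Lambda>_ge_1 r_pos by (intro mult_right_mono) auto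
    moreover have \<sigma>0: "0 \<le> \<sigma>" unfolding \<sigma>_def using \<tau> \<Lambda>_ge_1 r_pos by (intro mult_nonneg_nonneg) auto
    ultimately have "dist x p \<le> 40 * \<Lambda> * r"
      using dist_shift[of \<sigma> z] z(1) r_le r_pos unfolding p by linarith
    from bdist_lower[OF this] have "h p / \<Lambda> \<le> bdist \<Omega> p" .
    moreover have "\<epsilon> * r / \<Lambda> \<le> h p / \<Lambda>"
      using z hz \<sigma>0 \<Lambda>_ge_1 by (intro divide_right_mono) (auto simp: p h_shift)
    ultimately show "\<epsilon> * r / \<Lambda> \<le> bdist \<Omega> p" by linarith
  next
    have "dist Z z = 6 * \<Lambda> * r" using norm_e r_le r_pos by (simp add: Z_def dist_norm)
    also have "\<dots> = 48 * \<Lambda>\<^sup>2 * (r / \<Lambda> / 8)" using \<Lambda>_ge_1 by (simp add: power2_eq_square)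
    also have "\<dots> \<le> real n * \<epsilon> * (r / \<Lambda> / 8)" using n r_pos \<Lambda>_ge_1 by (intro mult_right_mono) auto
    finally show "dist Z z \<le> real n * (\<epsilon> * r / \<Lambda> / 8)" by simp
  qed
  have "u T \<le> K ^ n * (K ^ n * u z)"
    using TZ Zz K_ge_1 by (meson mult_left_mono order_trans zero_le_power zero_le_one)
  then have uT: "u T \<le> K ^ (2 * n) * u z" by (simp only: mult_2 power_add mult.assoc)
  have "u y * h y ^ p \<le> u T * s ^ p" using s(3) by (simp add: T_def)
  also have "\<dots> \<le> (K ^ (2 * n) * u z) * (12 * \<Lambda> * r) ^ p"
    using uT s r_le r_pos K_ge_1 u_nonneg[OF z_in] by (intro mult_mono power_mono) auto
  finally show ?thesis .
qed

text \<open>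
  Consider a maximum point \<open>m\<close> of \<open>u b * (r - dist x b) ^ p\<close>, and put \<open>d = r - dist x m\<close>. On the ball of radius
  \<open>d / 2\<close> around \<open>m\<close> maximality gives \<open>u \<le> 2 ^ p * u m\<close>. If the height of \<open>m\<close> were at most
  \<open>d / (2 * 6 ^ k)\<close>, then \<open>k\<close> decay steps inside this ball would give \<open>u m < u m\<close>. So the height of \<open>m\<close> is comparable
  to \<open>d\<close>, and the weight \<open>d ^ p\<close> compensates the negative power of the height in
  \<open>interior_comparison\<close>.
\<close>

lemma carleson:
  assumes K: "K \<le> (1 + 1 / (8 * \<Lambda>)) ^ p" and p: "0 < p"
    and k: "decay_factor TYPE('a) \<Lambda> ^ k * 2 ^ p < 1"
    and z: "dist x z = r" "\<epsilon> * r \<le> bdist \<Omega> z" "0 < \<epsilon>"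
    and n: "32 * \<Lambda> \<le> real n" "48 * \<Lambda>\<^sup>2 \<le> real n * \<epsilon>"
    and y: "y \<in> \<Omega>" "dist x y \<le> r / 2"
  shows "u y \<le> (48 * \<Lambda> * 6 ^ k) ^ p * K ^ (2 * n) * u z"
proof -
  have "0 < bdist \<Omega> z" using z r_pos by (meson less_le_trans mult_pos_pos)
  then have z_in: "z \<in> \<Omega>" by (cases "z \<in> \<Omega>") (auto simp: bdist_def)
  define G where "G b = U b * (r - dist x b) ^ p" for b
  have sub: "cball x r \<subseteq> ball x \<rho>" using in_chart_ball[OF near_center] by (auto simp del: mem_ball)
  have "compact (closure \<Omega> \<inter> cball x r)" by (simp add: closed_Int_compact)
  moreover have "continuous_on (closure \<Omega> \<inter> cball x r) G"
    unfolding G_def using sub by (intro continuous_intros continuous_on_subset[OF U_cont]) auto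
  moreover have "closure \<Omega> \<inter> cball x r \<noteq> {}" using x_in r_pos closure_subset[of \<Omega>] by auto
  ultimately obtain m where m: "m \<in> closure \<Omega> \<inter> cball x r"
    "\<And>b. b \<in> closure \<Omega> \<inter> cball x r \<Longrightarrow> G b \<le> G m"
    using continuous_attains_sup[of "closure \<Omega> \<inter> cball x r" G] by blast
  define B where "B = (24 * \<Lambda> * r * 6 ^ k) ^ p * K ^ (2 * n) * u z"
  have B: "0 \<le> B" using \<Lambda>_ge_1 r_pos K_ge_1 u_nonneg[OF z_in] by (simp add: B_def)
  have "G m \<le> B"
  proof (rule ccontr)
    assume "\<not> G m \<le> B"
    then have G_pos: "0 < G m" using B by linarith
    then have m_in: "m \<in> \<Omega>" using U_zero[of m] by (cases "m \<in> \<Omega>") (auto simp: G_def)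
    define d where "d = r - dist x m"
    have d: "0 < d"
    proof -
      have "d \<noteq> 0" using G_pos p by (auto simp: G_def d_def zero_power)
      then show ?thesis using m(1) by (simp add: d_def)
    qed
    have Gm: "G m = u m * d ^ p" by (simp add: G_def d_def U_eq m_in)
    have um: "0 < u m" using G_pos d by (simp add: Gm zero_less_mult_iff)
    have xm: "dist x m \<le> r" using m(1) by simp
    have hm: "0 < h m" using in_\<Omega>_iff[OF near_center, of m] m_in xm by auto
    show False
    proof (cases "6 ^ k * h m \<le> d / 2")
      case True
      have "u m \<le> decay_factor TYPE('a) \<Lambda> ^ k * (2 ^ p * u m)"
      proof (rule decay[of m "h m"])
        show "cball m (6 ^ k * h m) \<subseteq> ball x \<rho>"
        proof
          fix b assume "b \<in> cball m (6 ^ k * h m)"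
          then have "dist x b \<le> r" using dist_triangle[of x b m] True d by (simp add: d_def)
          then show "b \<in> ball x \<rho>" using sub by auto
        qed
        fix b assume b: "b \<in> \<Omega>" "dist m b \<le> 6 ^ k * h m"
        then have db: "d / 2 \<le> r - dist x b" using dist_triangle[of x b m] True by (simp add: d_def)
        then have "b \<in> closure \<Omega> \<inter> cball x r" using b closure_subset[of \<Omega>] d by auto
        from m(2)[OF this] have "u b * (r - dist x b) ^ p \<le> u m * d ^ p"
          by (simp add: Gm) (simp add: G_def U_eq b)
        moreover have "u b * (d / 2) ^ p \<le> u b * (r - dist x b) ^ p"
          using db d u_nonneg[OF b(1)] by (intro mult_left_mono power_mono) auto
        ultimately have "u b * (d / 2) ^ p \<le> (2 ^ p * u m) * (d / 2) ^ p"
          by (simp add: power_divide)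
        then show "u b \<le> 2 ^ p * u m" using d by (simp add: mult_le_cancel_right)
      qed (use m_in hm um in auto)
      also have "\<dots> < 1 * u m"
        using mult_strict_right_mono[OF k um] by (simp add: mult_ac)
      finally show False by simp
    next
      case False
      then have "d ^ p \<le> (2 * 6 ^ k * h m) ^ p" using d by (intro power_mono) auto
      then have "G m \<le> u m * (2 * 6 ^ k * h m) ^ p" unfolding Gm using um by (intro mult_left_mono) auto
      also have "\<dots> = (2 * 6 ^ k) ^ p * (u m * h m ^ p)" by (simp only: power_mult_distrib mult_ac)
      also have "\<dots> \<le> (2 * 6 ^ k) ^ p * (K ^ (2 * n) * u z * (12 * \<Lambda> * r) ^ p)"
        by (intro mult_left_mono interior_comparison[OF m_in xm K z n]) auto
      also have "\<dots> = (2 * 6 ^ k * (12 * \<Lambda> * r)) ^ p * (K ^ (2 * n) * u z)"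
        by (simp only: power_mult_distrib mult_ac)
      also have "2 * 6 ^ k * (12 * \<Lambda> * r) = 24 * \<Lambda> * r * 6 ^ k" by simp
      also have "(24 * \<Lambda> * r * 6 ^ k) ^ p * (K ^ (2 * n) * u z) = B" by (simp add: B_def)
      finally show False using \<open>\<not> G m \<le> B\<close> by simp
    qed
  qed
  moreover have "G y \<le> G m" using y closure_subset[of \<Omega>] r_pos by (intro m(2)) auto
  moreover have "u y * (r / 2) ^ p \<le> G y"
    unfolding G_def U_eq[OF y(1)] using y u_nonneg[OF y(1)] r_pos by (intro mult_left_mono power_mono) auto
  ultimately have "u y * (r / 2) ^ p \<le> B" by linarith
  also have "B = ((48 * \<Lambda> * 6 ^ k) ^ p * K ^ (2 * n) * u z) * (r / 2) ^ p"
  proof -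
    have "24 * \<Lambda> * r * 6 ^ k = (48 * \<Lambda> * 6 ^ k) * (r / 2)" by simp
    then show ?thesis unfolding B_def by (simp only: power_mult_distrib mult_ac)
  qed
  finally show ?thesis using r_pos by (simp add: mult_le_cancel_right)
qed

lemma small_near_boundary:
  assumes "K \<le> (1 + 1 / (8 * \<Lambda>)) ^ p" "0 < p"
    "decay_factor TYPE('a) \<Lambda> ^ k * 2 ^ p < 1"
    and z: "dist x z = r" "\<epsilon> * r \<le> bdist \<Omega> z" "0 < \<epsilon>"
    and n: "32 * \<Lambda> \<le> real n" "48 * \<Lambda>\<^sup>2 \<le> real n * \<epsilon>"
    and j: "6 ^ j * h x \<le> r / 2"
  shows "u x \<le> decay_factor TYPE('a) \<Lambda> ^ j * ((48 * \<Lambda> * 6 ^ k) ^ p * K ^ (2 * n) * u z)"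
proof (rule decay[of x "h x"])
  have "0 < bdist \<Omega> z" using z r_pos by (meson less_le_trans mult_pos_pos)
  then have z_in: "z \<in> \<Omega>" by (cases "z \<in> \<Omega>") (auto simp: bdist_def)
  show "0 \<le> (48 * \<Lambda> * 6 ^ k) ^ p * K ^ (2 * n) * u z"
    using \<Lambda>_ge_1 K_ge_1 u_nonneg[OF z_in] by simp
  show "cball x (6 ^ j * h x) \<subseteq> ball x \<rho>"
  proof
    fix b assume "b \<in> cball x (6 ^ j * h x)"
    then have "dist x b \<le> r" using j r_pos by auto
    then show "b \<in> ball x \<rho>" by (intro in_chart_ball near_center)
  qed
  show "u b \<le> (48 * \<Lambda> * 6 ^ k) ^ p * K ^ (2 * n) * u z" if "b \<in> \<Omega>" "dist x b \<le> 6 ^ j * h x" for b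
    using that j by (intro carleson[OF assms(1-3) z n]) auto
qed (use x_in h_x_pos in auto)

end

section \<open>Lipschitz domains and the absorption equation\<close>

text \<open>
  By compactness of the boundary the radius and the Lipschitz constant of the charts can be chosen
  uniformly. The constant \<open>1 + 2 L\<close> comes from the height \<open>y \<bullet> e\<close> and from the crude bound \<open>2\<close> for the
  projection along \<open>e\<close>.
\<close>

lemma lipschitz_domain_charts:
  fixes \<Omega> :: "'a::euclidean_space set"
  assumes "bounded \<Omega>" "lipschitz_domain \<Omega>"
  shows "\<exists>r0>0. \<exists>\<Lambda>\<ge>1. \<forall>q\<in>frontier \<Omega>. \<exists>e h. graph_chart \<Omega> q r0 e h \<Lambda>"
proof -
  have "\<exists>r>0. \<exists>e h \<Lambda>. graph_chart \<Omega> z r e h \<Lambda>" if "z \<in> frontier \<Omega>" for z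
  proof -
    have "\<forall>z\<in>frontier \<Omega>. \<exists>r>0. \<exists>e. \<exists>\<phi> :: 'a \<Rightarrow> real. \<exists>L.
        norm e = 1 \<and> L-lipschitz_on {y. y \<bullet> e = 0} \<phi> \<and>
        \<Omega> \<inter> ball z r = {x \<in> ball z r. \<phi> (x - (x \<bullet> e) *\<^sub>R e) < x \<bullet> e}"
      using assms(2) unfolding lipschitz_domain_def by (elim conjE)
    from bspec[OF this that] show ?thesis
    proof (elim exE conjE)
      fix r e L and \<phi> :: "'a \<Rightarrow> real" assume r: "0 < r" and e: "norm e = 1"
        and L: "L-lipschitz_on {y. y \<bullet> e = 0} \<phi>"
        and \<Omega>: "\<Omega> \<inter> ball z r = {x \<in> ball z r. \<phi> (x - (x \<bullet> e) *\<^sub>R e) < x \<bullet> e}"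
      have ee: "e \<bullet> e = 1" using e by (simp add: dot_square_norm)
      define h where "h y = y \<bullet> e - \<phi> (y - (y \<bullet> e) *\<^sub>R e)" for y
      have L0: "0 \<le> L" using L by (rule lipschitz_on_nonneg)
      have "graph_chart \<Omega> z r e h (1 + 2 * L)"
        unfolding graph_chart_def
      proof (intro conjI allI ballI)
        show "norm e = 1" "1 \<le> 1 + 2 * L" using e L0 by auto
        show "h (y + s *\<^sub>R e) = h y + s" for y s
          by (simp add: h_def inner_add_left ee algebra_simps)
        show "\<bar>h y - h w\<bar> \<le> (1 + 2 * L) * dist y w" for y w
        proof -
          have inner: "\<bar>(y - w) \<bullet> e\<bar> \<le> dist y w"
            using Cauchy_Schwarz_ineq2[of "y - w" e] e by (simp add: dist_norm)
          have "dist (\<phi> (y - (y \<bullet> e) *\<^sub>R e)) (\<phi> (w - (w \<bullet> e) *\<^sub>R e))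
              \<le> L * dist (y - (y \<bullet> e) *\<^sub>R e) (w - (w \<bullet> e) *\<^sub>R e)"
            by (rule lipschitz_onD[OF L]) (auto simp: inner_diff_left ee)
          also have "dist (y - (y \<bullet> e) *\<^sub>R e) (w - (w \<bullet> e) *\<^sub>R e) = norm ((y - w) - ((y - w) \<bullet> e) *\<^sub>R e)"
            by (simp add: dist_norm inner_diff_left algebra_simps)
          also have "\<dots> \<le> 2 * dist y w"
            using norm_triangle_ineq4[of "y - w" "((y - w) \<bullet> e) *\<^sub>R e"] inner e by (simp add: dist_norm)
          finally have "\<bar>\<phi> (y - (y \<bullet> e) *\<^sub>R e) - \<phi> (w - (w \<bullet> e) *\<^sub>R e)\<bar> \<le> L * (2 * dist y w)"
            using L0 by (simp add: dist_real_def mult_left_mono)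
          then show ?thesis using inner by (simp add: h_def inner_diff_left algebra_simps)
        qed
        show "y \<in> \<Omega> \<longleftrightarrow> 0 < h y" if "y \<in> ball z r" for y
          using arg_cong[OF \<Omega>, of "\<lambda>S. y \<in> S"] that by (simp add: h_def)
      qed
      with r show ?thesis by blast
    qed
  qed
  then obtain r e h \<Lambda> where ch: "\<And>z. z \<in> frontier \<Omega> \<Longrightarrow> 0 < r z"
    "\<And>z. z \<in> frontier \<Omega> \<Longrightarrow> graph_chart \<Omega> z (r z) (e z) (h z) (\<Lambda> z)"
    by metis
  have "compact (frontier \<Omega>)" using assms(1) by (rule compact_frontier_bounded)
  moreover have "frontier \<Omega> \<subseteq> (\<Union>z\<in>frontier \<Omega>. ball z (r z / 2))" using ch(1) by force
  ultimately obtain A where A: "A \<subseteq> frontier \<Omega>" "finite A" "frontier \<Omega> \<subseteq> (\<Union>z\<in>A. ball z (r z / 2))"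
    using compactE_image[of "frontier \<Omega>" "frontier \<Omega>" "\<lambda>z. ball z (r z / 2)"] by auto
  define r0 where "r0 = Min (insert 1 ((\<lambda>z. r z / 2) ` A))"
  define \<Lambda>0 where "\<Lambda>0 = Max (insert 1 (\<Lambda> ` A))"
  have "0 < r0" using A ch(1) by (auto simp: r0_def)
  moreover have "1 \<le> \<Lambda>0" using A by (simp add: \<Lambda>0_def)
  moreover have "\<exists>e h. graph_chart \<Omega> q r0 e h \<Lambda>0" if q: "q \<in> frontier \<Omega>" for q
  proof -
    obtain z where z: "z \<in> A" "dist z q < r z / 2" using A(3) q by auto
    have c: "graph_chart \<Omega> z (r z) (e z) (h z) (\<Lambda> z)" using ch z A by blast
    have "r0 \<le> r z / 2" unfolding r0_def using z A(2) by (intro Min_le) auto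
    have "\<Lambda> z \<le> \<Lambda>0" unfolding \<Lambda>0_def using z A(2) by (intro Max_ge) auto
    have "ball q r0 \<subseteq> ball z (r z)"
    proof
      fix y assume "y \<in> ball q r0"
      then show "y \<in> ball z (r z)"
        using z dist_triangle[of z y q] \<open>r0 \<le> r z / 2\<close> by simp
    qed
    moreover have "\<Lambda> z * dist y w \<le> \<Lambda>0 * dist y w" for y w :: 'a
      using \<open>\<Lambda> z \<le> \<Lambda>0\<close> by (intro mult_right_mono) auto
    ultimately have "graph_chart \<Omega> q r0 (e z) (h z) \<Lambda>0"
      using c \<open>1 \<le> \<Lambda>0\<close> unfolding graph_chart_def by (meson order_trans subsetD)
    then show ?thesis by blast
  qed
  ultimately show ?thesis by blast
qed

lemma continuous_on_zero_extension:
  fixes \<Omega> :: "'a::euclidean_space set"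
  assumes "open \<Omega>" and u: "continuous_on \<Omega> u" and v: "vanishes_on \<Omega> u (frontier \<Omega> - F)"
  shows "continuous_on (closure \<Omega> - F) (\<lambda>z. if z \<in> \<Omega> then u z else 0)"
proof -
  let ?U = "\<lambda>z. if z \<in> \<Omega> then u z else 0"
  have "(?U \<longlongrightarrow> ?U z) (at z within closure \<Omega> - F)" if z: "z \<in> closure \<Omega> - F" for z
  proof (cases "z \<in> \<Omega>")
    case True
    have "continuous_on \<Omega> ?U" using u by (rule continuous_on_eq) auto
    then have "isCont ?U z" by (rule continuous_on_interior) (use True \<open>open \<Omega>\<close> in \<open>simp add: interior_open\<close>)
    then show ?thesis
      unfolding isCont_def by (rule tendsto_within_subset) simp
  next
    case False
    then have "z \<in> frontier \<Omega> - F" using z \<open>open \<Omega>\<close> by (auto simp: frontier_def interior_open)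
    then have lim: "(u \<longlongrightarrow> 0) (at z within \<Omega>)" using v by (simp add: vanishes_on_def)
    show ?thesis
    proof (rule tendstoI)
      fix \<epsilon> :: real assume "0 < \<epsilon>"
      with lim obtain d where "0 < d" "\<And>y. y \<in> \<Omega> \<Longrightarrow> y \<noteq> z \<Longrightarrow> dist y z < d \<Longrightarrow> dist (u y) 0 < \<epsilon>"
        unfolding tendsto_iff eventually_at by metis
      then show "\<forall>\<^sub>F y in at z within closure \<Omega> - F. dist (?U y) (?U z) < \<epsilon>"
        unfolding eventually_at using False \<open>0 < \<epsilon>\<close> by (intro exI[of _ d]) auto
    qed
  qed
  then show ?thesis by (simp add: continuous_on_def)
qed

lemma bdist_ball: "z \<in> ball y (bdist \<Omega> y) \<Longrightarrow> z \<in> \<Omega>"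
  using infdist_le[of z "- \<Omega>" y] by (cases "z \<in> \<Omega>") (auto simp: bdist_def)

locale absorption =
  fixes \<Omega> :: "'a::euclidean_space set" and g :: "'a \<Rightarrow> real \<Rightarrow> real"
  assumes dom: "bounded \<Omega>" "open \<Omega>" "connected \<Omega>"
    and g_nonneg: "\<And>x t. x \<in> \<Omega> \<Longrightarrow> 0 \<le> t \<Longrightarrow> 0 \<le> g x t"
    and g_cont: "continuous_on (\<Omega> \<times> {0..}) (\<lambda>(x, t). g x t)"
    and g_mono: "\<And>x. x \<in> \<Omega> \<Longrightarrow> mono_on {0<..} (\<lambda>t. g x t / t)"
begin

lemma g_ratio: "x \<in> \<Omega> \<Longrightarrow> 0 < s \<Longrightarrow> s \<le> t \<Longrightarrow> g x s \<le> s * (g x t / t)"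
  using monotone_onD[OF g_mono, of x s t] by (simp add: field_simps)

lemma g_zero:
  assumes x: "x \<in> \<Omega>"
  shows "g x 0 = 0"
proof -
  have "continuous_on {0..} ((\<lambda>(x, t). g x t) \<circ> (\<lambda>t. (x, t)))"
    by (intro continuous_on_compose continuous_on_subset[OF g_cont] continuous_intros) (use x in auto)
  then have "(g x \<longlongrightarrow> g x 0) (at 0 within {0..})" by (simp add: continuous_on_def)
  then have 1: "(g x \<longlongrightarrow> g x 0) (at_right 0)" by (rule tendsto_within_subset) auto
  have "((\<lambda>t. t * (g x 1 / 1)) \<longlongrightarrow> 0 * (g x 1 / 1)) (at_right 0)" by (intro tendsto_intros)
  then have 2: "((\<lambda>t. t * (g x 1 / 1)) \<longlongrightarrow> 0) (at_right 0)" by simp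
  have "\<forall>\<^sub>F t in at_right 0. g x t \<le> t * (g x 1 / 1)"
    unfolding eventually_at_right_field using g_ratio[OF x, of _ 1] by (intro exI[of _ 1]) auto
  then have "g x 0 \<le> 0" by (intro tendsto_le[OF _ 2 1]) auto
  then show ?thesis using g_nonneg[OF x, of 0] by simp
qed

lemma compl_nonempty: "- \<Omega> \<noteq> {}"
  using dom(1) by (metis Compl_UNIV_eq double_complement not_bounded_UNIV)

context
  fixes u :: "'a \<Rightarrow> real"
  assumes u: "nonneg_solution \<Omega> g u"
begin

lemma u_nonneg: "z \<in> \<Omega> \<Longrightarrow> 0 \<le> u z" and u_cont: "continuous_on \<Omega> u"
  using u by (auto simp: nonneg_solution_def)

lemmas u_poisson = nonneg_solution_weak_poisson[OF u dom(2) g_cont]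

lemma absorption_nonneg: "z \<in> \<Omega> \<Longrightarrow> 0 \<le> g z (u z)"
  by (simp add: g_nonneg u_nonneg)

text \<open>
  On a compact ball where \<open>u \<le> M\<close>, monotonicity gives \<open>g b (u b) \<le> (g b M / M) * u b\<close>, so the equation is
  locally of the form \<open>\<Delta>u = V u\<close> with bounded \<open>V\<close> and a single zero forces \<open>u = 0\<close>.
\<close>

lemma solution_positive:
  assumes x: "x \<in> \<Omega>" "0 < u x" and y: "y \<in> \<Omega>"
  shows "0 < u y"
proof (rule ccontr)
  assume "\<not> 0 < u y"
  then have uy: "u y = 0" using u_nonneg[OF y] by simp
  have "\<exists>R>0. \<exists>\<Lambda>\<ge>0. cball z R \<subseteq> \<Omega> \<and> (\<forall>b\<in>cball z R. g b (u b) \<le> \<Lambda> * u b)" if z: "z \<in> \<Omega>" for z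
  proof -
    obtain R where R: "0 < R" "cball z R \<subseteq> \<Omega>" using dom(2) z open_contains_cball by blast
    have "continuous_on (cball z R) u" using u_cont R(2) by (rule continuous_on_subset)
    then have "bounded (u ` cball z R)"
      by (intro compact_imp_bounded compact_continuous_image) auto
    then obtain M where M: "0 < M" "\<And>b. b \<in> cball z R \<Longrightarrow> u b \<le> M"
      unfolding bounded_pos by (metis abs_le_D1 imageI real_norm_def)
    have "continuous_on (cball z R) ((\<lambda>(x, t). g x t) \<circ> (\<lambda>b. (b, M)))"
      by (intro continuous_on_compose continuous_on_subset[OF g_cont] continuous_intros) (use R M in auto)
    then have "bounded ((\<lambda>b. g b M) ` cball z R)"
      by (intro compact_imp_bounded compact_continuous_image) (auto simp: o_def)
    then obtain G where G: "0 < G" "\<And>b. b \<in> cball z R \<Longrightarrow> g b M \<le> G"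
      unfolding bounded_pos by (metis abs_le_D1 imageI real_norm_def)
    have "g b (u b) \<le> G / M * u b" if b: "b \<in> cball z R" for b
    proof (cases "u b = 0")
      case True
      then show ?thesis using g_zero[of b] R b by auto
    next
      case False
      have b': "b \<in> \<Omega>" using R b by auto
      have "g b (u b) \<le> u b * (g b M / M)"
        using False u_nonneg[OF b'] M(2)[OF b] by (intro g_ratio b') auto
      also have "\<dots> \<le> u b * (G / M)"
        using G(2)[OF b] M(1) u_nonneg[OF b'] by (intro mult_left_mono divide_right_mono) auto
      finally show ?thesis by (simp add: mult.commute)
    qed
    then show ?thesis using R G M by (intro exI[of _ R] conjI exI[of _ "G / M"]) auto
  qed
  from vanishes_everywhere[OF u_poisson dom(3) u_nonneg this y uy x(1)] x(2) show False by simp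
qed

text \<open>
  This settles the case \<open>F = {}\<close>, where the asserted bound is \<open>0\<close>.
\<close>

lemma solution_zero:
  assumes v: "vanishes_on \<Omega> u (frontier \<Omega>)" and x: "x \<in> \<Omega>"
  shows "u x = 0"
proof -
  let ?U = "\<lambda>z. if z \<in> \<Omega> then u z else 0"
  have "?U x \<le> 0"
  proof (rule max_principle[OF u_poisson dom(2,1) order_refl absorption_nonneg _ _ _ x])
    show "continuous_on (closure \<Omega>) ?U"
      using continuous_on_zero_extension[OF dom(2) u_cont, of "{}"] v by simp
    show "?U z \<le> 0" if "z \<in> frontier \<Omega>" for z
      using that dom(2) by (auto simp: frontier_def interior_open)
  qed auto
  then show ?thesis using x u_nonneg[OF x] by simp
qed

lemma solution_harnack:
  assumes C: "0 \<le> C" and bound: "\<And>z. z \<in> \<Omega> \<Longrightarrow> g z (u z) \<le> C / (bdist \<Omega> z)\<^sup>2 * u z"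
    and ab: "b \<in> \<Omega>" "dist a b \<le> bdist \<Omega> b / 8"
  shows "u a \<le> 2 * 4 ^ DIM('a) * exp (3 + C) * u b"
proof -
  have b: "0 < bdist \<Omega> b"
    unfolding bdist_def using dom(2) ab compl_nonempty
    by (intro infdist_pos_not_in_closed) auto
  define R where "R = bdist \<Omega> b / 2"
  have R: "0 < R" "cball b R \<subseteq> \<Omega>" using b bdist_ball[of _ b] by (auto simp: R_def subset_eq)
  show ?thesis
  proof (rule harnack[OF u_poisson R C])
    fix z assume z: "z \<in> ball b R"
    then have z': "z \<in> \<Omega>" using R by auto
    show "0 \<le> g z (u z)" "0 \<le> u z" using z' by (auto intro: absorption_nonneg u_nonneg)
    have "bdist \<Omega> b \<le> bdist \<Omega> z + dist b z" unfolding bdist_def by (rule infdist_triangle)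
    then have "R \<le> bdist \<Omega> z" using z by (simp add: R_def)
    then have "C / (bdist \<Omega> z)\<^sup>2 * u z \<le> C / R\<^sup>2 * u z"
      using R(1) C u_nonneg[OF z'] by (intro mult_right_mono divide_left_mono power_mono) auto
    then show "g z (u z) \<le> C / R\<^sup>2 * u z" using bound[OF z'] by linarith
  qed (use ab in \<open>simp add: R_def\<close>)
qed

end

end

theorem theoremA11:
  fixes \<Omega> :: "'a::euclidean_space set"
    and g :: "'a \<Rightarrow> real \<Rightarrow> real"
    and C \<epsilon>\<^sub>0 :: real
  assumes "bounded \<Omega>" and "lipschitz_domain \<Omega>"
    and "\<And>x t. x \<in> \<Omega> \<Longrightarrow> 0 \<le> t \<Longrightarrow> 0 \<le> g x t"
    and "continuous_on (\<Omega> \<times> {0..}) (\<lambda>(x, t). g x t)"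
    and "\<And>x. x \<in> \<Omega> \<Longrightarrow> mono_on {0<..} (\<lambda>t. g x t / t)"
    and "1 \<le> C" and "0 < \<epsilon>\<^sub>0"
    and "quasi_inwardly_increasing C \<epsilon>\<^sub>0 \<Omega> g"
    and "\<And>u x. positive_solution \<Omega> g u \<Longrightarrow> x \<in> \<Omega> \<Longrightarrow> g x (u x) \<le> C / (bdist \<Omega> x)\<^sup>2 * u x"
  shows "\<exists>c>0. \<forall>F u. closed F \<and> F \<subseteq> frontier \<Omega> \<and> nonneg_solution \<Omega> g u \<and>
           vanishes_on \<Omega> u (frontier \<Omega> - F) \<longrightarrow>
           (\<forall>x\<in>\<Omega>. g x (u x) \<le> c / (infdist x F)\<^sup>2 * u x)"
proof -
  note C = \<open>1 \<le> C\<close> and \<epsilon> = \<open>0 < \<epsilon>\<^sub>0\<close>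
  have "open \<Omega>" "connected \<Omega>" using assms(2) by (auto simp: lipschitz_domain_def)
  then interpret absorption \<Omega> g
    using assms(1,3-5) by unfold_locales
  obtain r0 \<Lambda> where r0: "0 < r0" and \<Lambda>: "1 \<le> \<Lambda>"
    and charts: "\<And>q. q \<in> frontier \<Omega> \<Longrightarrow> \<exists>e h. graph_chart \<Omega> q r0 e h \<Lambda>"
    using lipschitz_domain_charts[OF assms(1,2)] by blast
  define K :: real where "K = 2 * 4 ^ DIM('a) * exp (3 + C)"
  have K: "1 \<le> K"
  proof -
    have "1 * 1 * 1 \<le> K" unfolding K_def using C by (intro mult_mono) auto
    then show ?thesis by simp
  qed
  let ?\<theta> = "decay_factor TYPE('a) \<Lambda>"
  have \<theta>: "0 \<le> ?\<theta>" "?\<theta> < 1" using decay_factor_bounds[OF \<Lambda>, where 'a='a] by auto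
  obtain p0 where "K < (1 + 1 / (8 * \<Lambda>)) ^ p0" using real_arch_pow[of "1 + 1 / (8 * \<Lambda>)"] \<Lambda> by auto
  moreover have "(1 + 1 / (8 * \<Lambda>)) ^ p0 \<le> (1 + 1 / (8 * \<Lambda>)) ^ Suc p0"
    using \<Lambda> by (intro power_increasing) auto
  ultimately obtain p where p: "K \<le> (1 + 1 / (8 * \<Lambda>)) ^ p" "0 < p"
    by (meson less_le_trans less_imp_le zero_less_Suc)
  have small: "\<exists>k. ?\<theta> ^ k * M < 1" if "0 < M" for M :: real
    using real_arch_pow_inv[of "1 / M" ?\<theta>] \<theta> that by (auto simp: field_simps)
  obtain k where k: "?\<theta> ^ k * 2 ^ p < 1" using small[of "2 ^ p"] by auto
  obtain n where n: "32 * \<Lambda> \<le> real n" "48 * \<Lambda>\<^sup>2 \<le> real n * \<epsilon>\<^sub>0"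
  proof -
    obtain n where "max (32 * \<Lambda>) (48 * \<Lambda>\<^sup>2 / \<epsilon>\<^sub>0) \<le> real n" using real_arch_simple by blast
    then show ?thesis using that[of n] \<epsilon> by (simp add: field_simps)
  qed
  define B where "B = (48 * \<Lambda> * 6 ^ k) ^ p * K ^ (2 * n)"
  have B: "0 < B" using \<Lambda> K by (simp add: B_def)
  obtain j where j: "?\<theta> ^ j * (B * C) < 1" using small[of "B * C"] B C by auto
  obtain D where D: "0 < D" "\<And>x y. x \<in> \<Omega> \<Longrightarrow> y \<in> frontier \<Omega> \<Longrightarrow> dist x y \<le> D"
  proof -
    obtain b where b: "\<And>z. z \<in> closure \<Omega> \<Longrightarrow> norm z \<le> b"
      using bounded_closure[OF assms(1)] unfolding bounded_iff by blast
    have "dist x y \<le> 2 * \<bar>b\<bar> + 1" if "x \<in> \<Omega>" "y \<in> frontier \<Omega>" for x y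
    proof -
      have "x \<in> closure \<Omega>" "y \<in> closure \<Omega>"
        using that closure_subset[of \<Omega>] by (auto simp: frontier_def)
      then show ?thesis
        using b[of x] b[of y] norm_triangle_ineq4[of x y] unfolding dist_norm by linarith
    qed
    then show ?thesis using that[of "2 * \<bar>b\<bar> + 1"] by auto
  qed
  \<comment> \<open>The three bounds keep the chart around \<open>x\<close> away from \<open>F\<close>, inside a chart around the nearest boundary point, and \<open>r\<close> below \<open>\<epsilon>\<^sub>0\<close>.\<close>
  define c1 where "c1 = min (1 / (100 * \<Lambda>)) (min (r0 / (101 * \<Lambda> * D)) (\<epsilon>\<^sub>0 / (2 * D)))"
  \<comment> \<open>Points with \<open>bdist \<Omega> x < c2 * r\<close> have height at most \<open>r / 2 / 6 ^ j\<close>, which allows \<open>j\<close> decay steps.\<close>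
  define c2 where "c2 = 1 / (2 * \<Lambda> * 6 ^ j)"
  have c1: "0 < c1" and c2: "0 < c2" using \<Lambda> r0 D \<epsilon> by (auto simp: c1_def c2_def)
  have c1_le: "100 * \<Lambda> * c1 \<le> 1" "101 * \<Lambda> * (c1 * D) \<le> r0" "c1 * D < \<epsilon>\<^sub>0"
  proof -
    have "c1 \<le> 1 / (100 * \<Lambda>)" "c1 \<le> r0 / (101 * \<Lambda> * D)" "c1 \<le> \<epsilon>\<^sub>0 / (2 * D)" by (auto simp: c1_def)
    then have "c1 * (100 * \<Lambda>) \<le> 1" "c1 * (101 * \<Lambda> * D) \<le> r0" "c1 * (2 * D) \<le> \<epsilon>\<^sub>0"
      using \<Lambda> D(1) by (simp_all add: pos_le_divide_eq)
    then show "100 * \<Lambda> * c1 \<le> 1" "101 * \<Lambda> * (c1 * D) \<le> r0" "c1 * D < \<epsilon>\<^sub>0"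
      using \<epsilon> by (simp_all add: mult_ac)
  qed
  have c2_le: "c2 \<le> 1"
  proof -
    have "1 * 1 \<le> (2 * \<Lambda>) * 6 ^ j" using \<Lambda> by (intro mult_mono) auto
    then show ?thesis by (simp add: c2_def)
  qed
  define c where "c = C / (c2 * c1)\<^sup>2 + C ^ 3 / (\<epsilon>\<^sub>0 * c1)\<^sup>2"
  have c_parts: "0 < C / (c2 * c1)\<^sup>2" "0 < C ^ 3 / (\<epsilon>\<^sub>0 * c1)\<^sup>2" using C c1 c2 \<epsilon> by auto
  have inv_sq: "C / t\<^sup>2 \<le> C / s\<^sup>2" if "0 < s" "s \<le> t" for s t :: real
    using that C by (intro divide_left_mono power_mono mult_pos_pos zero_less_power) auto
  have main: "g x (u x) \<le> c / (infdist x F)\<^sup>2 * u x"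
    if F: "closed F" "F \<subseteq> frontier \<Omega>" and u: "nonneg_solution \<Omega> g u"
      and van: "vanishes_on \<Omega> u (frontier \<Omega> - F)" and x: "x \<in> \<Omega>" for F u x
  proof (cases "u x = 0")
    case True
    then show ?thesis using g_zero[OF x] by simp
  next
    case False
    then have ux: "0 < u x" using u_nonneg[OF u x] by simp
    have pos: "0 < u y" if "y \<in> \<Omega>" for y by (rule solution_positive[OF u x ux that])
    then have "positive_solution \<Omega> g u" using u by (simp add: positive_solution_def)
    from assms(9)[OF this] have bound: "g y (u y) \<le> C / (bdist \<Omega> y)\<^sup>2 * u y" if "y \<in> \<Omega>" for y
      using that by blast
    have F_ne: "F \<noteq> {}" using solution_zero[OF u _ x] van ux by auto
    define d where "d = infdist x F"
    have d: "0 < d" unfolding d_def using infdist_pos_of_closed_frontier[OF dom(2) x F(1) F_ne F(2)] .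
    obtain w where "w \<in> F" using F_ne by blast
    then have "d \<le> D" using infdist_le2[of w F x D] D(2)[OF x, of w] F(2) by (auto simp: d_def)
    define r where "r = c1 * d"
    have r: "0 < r" using c1 d by (simp add: r_def)
    have r_D: "r \<le> c1 * D" using \<open>d \<le> D\<close> c1 by (simp add: r_def)
    have "100 * \<Lambda> * c1 * d \<le> 1 * d" using c1_le(1) d by (intro mult_right_mono) auto
    then have r_d: "100 * \<Lambda> * r \<le> d" by (simp add: r_def mult.assoc)
    have "101 * \<Lambda> * r \<le> 101 * \<Lambda> * (c1 * D)" using r_D \<Lambda> by (intro mult_left_mono) auto
    then have r_r0: "101 * \<Lambda> * r \<le> r0" using c1_le(2) by linarith
    have r_\<epsilon>: "r < \<epsilon>\<^sub>0" using r_D c1_le(3) by linarith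
    have r_\<Lambda>: "r \<le> \<Lambda> * r" using r \<Lambda> by simp
    have reduce: "g x (u x) \<le> c / d\<^sup>2 * u x" if "g x (u x) \<le> c' / d\<^sup>2 * u x" "c' \<le> c" for c'
    proof -
      have "c' / d\<^sup>2 * u x \<le> c / d\<^sup>2 * u x"
        using that(2) ux by (intro mult_right_mono divide_right_mono) auto
      with that(1) show ?thesis by linarith
    qed
    have "g x (u x) \<le> c / d\<^sup>2 * u x"
    proof (cases "c2 * r \<le> bdist \<Omega> x")
      case True
      have "0 < c2 * r" using c2 r by simp
      then have "C / (bdist \<Omega> x)\<^sup>2 * u x \<le> C / (c2 * r)\<^sup>2 * u x"
        using inv_sq True ux by (intro mult_right_mono) auto
      also have "C / (c2 * r)\<^sup>2 = C / (c2 * c1)\<^sup>2 / d\<^sup>2"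
        unfolding r_def by (simp only: power_mult_distrib mult.assoc divide_divide_eq_left)
      finally have "g x (u x) \<le> C / (c2 * c1)\<^sup>2 / d\<^sup>2 * u x" using bound[OF x] by linarith
      then show ?thesis by (rule reduce) (use c_parts in \<open>simp add: c_def\<close>)
    next
      case False
      obtain q where q: "q \<in> - \<Omega>" "bdist \<Omega> x = dist x q"
        unfolding bdist_def
        using infdist_attains_inf[of "- \<Omega>" x, OF closed_Compl[OF dom(2)] compl_nonempty] by metis
      have q_fr: "q \<in> frontier \<Omega>"
      proof -
        have "ball x (dist x q) \<subseteq> \<Omega>" using bdist_ball[of _ x] q by auto
        moreover have "x \<noteq> q" using x q by auto
        ultimately have "cball x (dist x q) \<subseteq> closure \<Omega>"
          using closure_mono[of "ball x (dist x q)" \<Omega>] by (simp add: closure_ball)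
        then show ?thesis using q dom(2) by (auto simp: frontier_def interior_open)
      qed
      have "c2 * r \<le> 1 * r" using c2_le r by (intro mult_right_mono) auto
      then have xq: "dist x q < c2 * r" "dist x q < r" using False q by auto
      obtain e h where ch: "graph_chart \<Omega> q r0 e h \<Lambda>" using charts[OF q_fr] by blast
      define \<rho> where "\<rho> = 100 * \<Lambda> * r"
      have "ball x \<rho> \<subseteq> ball q r0"
      proof
        fix b assume "b \<in> ball x \<rho>"
        then have "dist q b < r0"
          using dist_triangle[of q b x] xq r_r0 r_\<Lambda> by (simp add: \<rho>_def dist_commute)
        then show "b \<in> ball q r0" by simp
      qed
      then have ch_x: "graph_chart \<Omega> x \<rho> e h \<Lambda>" using ch by (auto simp: graph_chart_def subset_eq)
      have "h q \<le> 0" using ch q(1) r0 by (auto simp: graph_chart_def)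
      moreover have "\<bar>h x - h q\<bar> \<le> \<Lambda> * dist x q" using ch by (simp add: graph_chart_def)
      moreover have "\<Lambda> * dist x q \<le> \<Lambda> * (c2 * r)" using xq \<Lambda> by (intro mult_left_mono) auto
      moreover have "\<Lambda> * (c2 * r) = r / 2 / 6 ^ j" using \<Lambda> by (simp add: c2_def)
      ultimately have hx: "h x \<le> r / 2 / 6 ^ j" by linarith
      then have hj: "6 ^ j * h x \<le> r / 2" by (simp add: field_simps)
      have "r / 2 / 6 ^ j \<le> r / 2 / 1" using r by (intro divide_left_mono) auto
      then have hx_r: "h x \<le> r" using hx r by linarith
      define U where "U z = (if z \<in> \<Omega> then u z else 0)" for z
      interpret harnack_chart \<Omega> u "\<lambda>z. g z (u z)" U x e \<rho> \<Lambda> h K r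
      proof unfold_locales
        show "weak_poisson \<Omega> u (\<lambda>z. g z (u z))" by (rule u_poisson[OF u])
        show "0 \<le> g z (u z)" if "z \<in> \<Omega>" for z by (rule absorption_nonneg[OF u that])
        have "ball x \<rho> \<inter> F = {}"
          using r_d infdist_le[of _ F x] by (force simp: \<rho>_def d_def)
        then show "continuous_on (closure \<Omega> \<inter> ball x \<rho>) U"
          unfolding U_def
          by (intro continuous_on_subset[OF continuous_on_zero_extension[OF dom(2) u_cont[OF u] van]]) auto
        show "u a \<le> K * u b" if "a \<in> \<Omega>" "b \<in> \<Omega>" "dist a b \<le> bdist \<Omega> b / 8" for a b
          unfolding K_def using C by (intro solution_harnack[OF u _ bound that(2,3)]) auto
      qed (use ch_x x r hx_r K pos compl_nonempty in \<open>auto simp: U_def \<rho>_def less_imp_le\<close>)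
      have "x \<in> near_boundary \<Omega> \<epsilon>\<^sub>0" using x q xq r_\<epsilon> by (simp add: near_boundary_def)
      then obtain z where z: "dist z x = r" "\<epsilon>\<^sub>0 * r \<le> bdist \<Omega> z" "g x (u x) \<le> C * g z (C * u x)"
        using assms(8) r r_\<epsilon> ux unfolding quasi_inwardly_increasing_def by blast
      have \<delta>z: "0 < \<epsilon>\<^sub>0 * r" using \<epsilon> r by simp
      then have z_in: "z \<in> \<Omega>" using z(2) by (cases "z \<in> \<Omega>") (auto simp: bdist_def)
      have "u x \<le> ?\<theta> ^ j * (B * u z)"
        unfolding B_def using small_near_boundary[OF p k _ z(2) \<epsilon> n hj] z(1) by (simp add: dist_commute)
      then have "C * u x \<le> C * (?\<theta> ^ j * (B * u z))" using C by (intro mult_left_mono) auto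
      also have "\<dots> = (?\<theta> ^ j * (B * C)) * u z" by (simp add: mult_ac)
      also have "\<dots> \<le> 1 * u z" using j pos[OF z_in] by (intro mult_right_mono) auto
      finally have Cu: "C * u x \<le> u z" by simp
      have "g z (C * u x) \<le> C * u x * (g z (u z) / u z)"
        using Cu C ux by (intro g_ratio[OF z_in]) auto
      also have "\<dots> \<le> C * u x * (C / (\<epsilon>\<^sub>0 * r)\<^sup>2)"
      proof (intro mult_left_mono)
        have "g z (u z) / u z \<le> C / (bdist \<Omega> z)\<^sup>2"
          using bound[OF z_in] pos[OF z_in] by (simp add: pos_divide_le_eq)
        also have "\<dots> \<le> C / (\<epsilon>\<^sub>0 * r)\<^sup>2"
          by (rule inv_sq[OF \<delta>z z(2)])
        finally show "g z (u z) / u z \<le> C / (\<epsilon>\<^sub>0 * r)\<^sup>2" .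
      qed (use C ux in auto)
      finally have "C * g z (C * u x) \<le> C * (C * u x * (C / (\<epsilon>\<^sub>0 * r)\<^sup>2))"
        using C by (intro mult_left_mono) auto
      with z(3) have "g x (u x) \<le> C * (C * u x * (C / (\<epsilon>\<^sub>0 * r)\<^sup>2))" by linarith
      also have "\<dots> = C ^ 3 / (\<epsilon>\<^sub>0 * c1)\<^sup>2 / d\<^sup>2 * u x"
        unfolding r_def power_mult_distrib power3_eq_cube by (simp add: mult_ac)
      finally show ?thesis by (rule reduce) (use c_parts in \<open>simp add: c_def\<close>)
    qed
    then show ?thesis by (simp add: d_def)
  qed
  have "0 < c" using c_parts by (simp add: c_def)
  with main show ?thesis by blast
qed

end
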